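(* Let $H_o$ be a Hilbert space. A unitary representation $(G,\pi,H)$ of a discrete group $G$ is unitarily equivalent to a subrepresentation of $\lambda\otimes id$ with multiplicity $H_o$ if and only if $(G,\pi,H)$ has an operator frame generator with range in $H_o$.
   Context: $G$ is a discrete group (not necessarily countable), $\lambda$ its left regular representation on $\ell^2(G)$. The left regular representation of $G$ with multiplicity $H_o$ is $\lambda\otimes id: g\mapsto\lambda_g\otimes I_o$ on $\ell^2(G)\otimes H_o$, where $I_o$ is the identity of $B(H_o)$. An operator $A\in B(H,H_o)$ is an operator frame generator with range in $H_o$ for $(G,\pi,H)$ if $\{A\pi_{g^{-1}}\}_{g\in G}$ is an operator-valued frame, i.e., $\sum_{g\in G}\pi_gA^*A\pi_{g^{-1}}$ converges in the strong operator topology (net of finite partial sums) to a bounded positive invertible operator on $H$. *)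

theory Defs
  imports "HOL-Analysis.Analysis"
begin

section \<open>Complex Hilbert spaces\<close>

text \<open>The inner product is linear in the first argument. Positivity and definiteness
  follow from the last axiom, since \<open>norm\<close> is a norm.\<close>

class complex_inner = real_normed_vector +
  fixes scaleC :: "complex \<Rightarrow> 'a \<Rightarrow> 'a" (infixr \<open>*\<^sub>C\<close> 75)
    and cinner :: "'a \<Rightarrow> 'a \<Rightarrow> complex"
  assumes scaleC_add_right: "c *\<^sub>C (x + y) = c *\<^sub>C x + c *\<^sub>C y"
    and scaleC_add_left: "(c + d) *\<^sub>C x = c *\<^sub>C x + d *\<^sub>C x"
    and scaleC_scaleC: "c *\<^sub>C d *\<^sub>C x = (c * d) *\<^sub>C x"
    and scaleC_of_real: "of_real r *\<^sub>C x = r *\<^sub>R x"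
    and cinner_commute: "cinner x y = cnj (cinner y x)"
    and cinner_add_left: "cinner (x + y) z = cinner x z + cinner y z"
    and cinner_scaleC_left: "cinner (c *\<^sub>C x) y = c * cinner x y"
    and cinner_self: "cinner x x = of_real ((norm x)\<^sup>2)"

class chilbert_space = complex_inner + banach

instantiation complex :: chilbert_space
begin
definition "scaleC_complex (c :: complex) (x :: complex) = c * x"
definition "cinner_complex (x :: complex) (y :: complex) = x * cnj y"
instance
proof
  fix x :: complex
  show "cinner x x = of_real ((norm x)\<^sup>2)"
    unfolding cinner_complex_def by (rule complex_norm_square[symmetric])
  fix y z c d :: complex and r :: real
  show "c *\<^sub>C (x + y) = c *\<^sub>C x + c *\<^sub>C y" by (simp add: scaleC_complex_def ring_distribs)
  show "(c + d) *\<^sub>C x = c *\<^sub>C x + d *\<^sub>C x" by (simp add: scaleC_complex_def ring_distribs)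
  show "c *\<^sub>C d *\<^sub>C x = (c * d) *\<^sub>C x" by (simp add: scaleC_complex_def)
  show "of_real r *\<^sub>C x = r *\<^sub>R x" by (simp add: scaleC_complex_def scaleR_conv_of_real)
  show "cinner x y = cnj (cinner y x)" by (simp add: cinner_complex_def)
  show "cinner (x + y) z = cinner x z + cinner y z" by (simp add: cinner_complex_def ring_distribs)
  show "cinner (c *\<^sub>C x) y = c * cinner x y" by (simp add: cinner_complex_def scaleC_complex_def)
qed
end
lemma scaleC_one [simp]: "1 *\<^sub>C (x :: 'a::complex_inner) = x"
  using scaleC_of_real[of 1 x] by simp

lemma scaleC_zero_left [simp]: "0 *\<^sub>C (x :: 'a::complex_inner) = 0"
  using scaleC_of_real[of 0 x] by simp

lemma scaleC_zero_right [simp]: "c *\<^sub>C (0 :: 'a::complex_inner) = 0"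
  using scaleC_add_right[of c "0::'a" 0] by simp

lemma scaleC_minus_right: "c *\<^sub>C (- x :: 'a::complex_inner) = - (c *\<^sub>C x)"
  using scaleC_add_right[of c x "- x"] by (simp add: eq_neg_iff_add_eq_0 add.commute)

lemma scaleC_diff_right: "c *\<^sub>C (x - y :: 'a::complex_inner) = c *\<^sub>C x - c *\<^sub>C y"
  using scaleC_add_right[of c x "- y"] by (simp add: scaleC_minus_right)

lemma cinner_add_right: "cinner (x :: 'a::complex_inner) (y + z) = cinner x y + cinner x z"
  by (metis cinner_add_left cinner_commute complex_cnj_add)

lemma cinner_scaleC_right: "cinner (x :: 'a::complex_inner) (c *\<^sub>C y) = cnj c * cinner x y"
  by (metis cinner_scaleC_left cinner_commute complex_cnj_mult)

lemma cinner_scaleR_left: "cinner (r *\<^sub>R x :: 'a::complex_inner) y = of_real r * cinner x y"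
  by (metis cinner_scaleC_left scaleC_of_real)

lemma cinner_scaleR_right: "cinner (x :: 'a::complex_inner) (r *\<^sub>R y) = of_real r * cinner x y"
  by (metis cinner_scaleC_right scaleC_of_real complex_cnj_complex_of_real)

lemma cinner_minus_left: "cinner (- x :: 'a::complex_inner) y = - cinner x y"
  using cinner_scaleR_left[of "-1" x y] by simp

lemma cinner_minus_right: "cinner (x :: 'a::complex_inner) (- y) = - cinner x y"
  using cinner_scaleR_right[of x "-1" y] by simp

lemma cinner_diff_left: "cinner (x - y :: 'a::complex_inner) z = cinner x z - cinner y z"
  using cinner_add_left[of x "- y" z] by (simp add: cinner_minus_left)

lemma cinner_diff_right: "cinner (x :: 'a::complex_inner) (y - z) = cinner x y - cinner x z"
  using cinner_add_right[of x y "- z"] by (simp add: cinner_minus_right)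

lemma cinner_zero_left [simp]: "cinner (0 :: 'a::complex_inner) y = 0"
  using cinner_scaleR_left[of 0 0 y] by simp

lemma cinner_zero_right [simp]: "cinner (x :: 'a::complex_inner) 0 = 0"
  using cinner_scaleR_right[of x 0 0] by simp

lemma cinner_eq_zero_all:
  assumes "\<And>x. cinner x (y :: 'a::complex_inner) = 0"
  shows "y = 0"
  using assms[of y] by (simp add: cinner_self)

lemma norm_sq_diff:
  "(norm (x - y :: 'a::complex_inner))\<^sup>2 = (norm x)\<^sup>2 + (norm y)\<^sup>2 - 2 * Re (cinner x y)"
proof -
  have "complex_of_real ((norm (x - y))\<^sup>2) = cinner x x + cinner y y - (cinner x y + cnj (cinner x y))"
    unfolding cinner_self[symmetric] cinner_diff_left cinner_diff_right
    using cinner_commute[of y x] by simp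
  also have "\<dots> = of_real ((norm x)\<^sup>2 + (norm y)\<^sup>2 - 2 * Re (cinner x y))"
    by (simp add: cinner_self complex_add_cnj)
  finally show ?thesis by (simp only: of_real_eq_iff)
qed

lemma norm_sq_add:
  "(norm (x + y :: 'a::complex_inner))\<^sup>2 = (norm x)\<^sup>2 + (norm y)\<^sup>2 + 2 * Re (cinner x y)"
  using norm_sq_diff[of x "- y"] by (simp add: cinner_minus_right)

lemma cinner_bound: "cmod (cinner (x :: 'a::complex_inner) y) \<le> norm x * norm y"
proof (cases "y = 0")
  case False
  define t where "t = cinner x y / of_real ((norm y)\<^sup>2)"
  have n: "norm y \<noteq> 0" using False by simp
  have "cinner (x - t *\<^sub>C y) (x - t *\<^sub>C y)
      = cinner x x - cnj t * cinner x y - t * cnj (cinner x y) + t * cnj t * cinner y y"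
    unfolding cinner_diff_left cinner_diff_right cinner_scaleC_left cinner_scaleC_right
    using cinner_commute[of y x] by (simp add: algebra_simps)
  also have "\<dots> = cinner x x - cinner x y * cnj (cinner x y) / of_real ((norm y)\<^sup>2)"
    using n by (simp add: t_def cinner_self field_simps power2_eq_square)
  also have "\<dots> = of_real ((norm x)\<^sup>2 - (cmod (cinner x y))\<^sup>2 / (norm y)\<^sup>2)"
    by (simp add: cinner_self complex_norm_square[symmetric])
  finally have "(norm x)\<^sup>2 - (cmod (cinner x y))\<^sup>2 / (norm y)\<^sup>2 = (norm (x - t *\<^sub>C y))\<^sup>2"
    by (simp only: cinner_self of_real_eq_iff)
  hence "(cmod (cinner x y))\<^sup>2 / (norm y)\<^sup>2 \<le> (norm x)\<^sup>2"
    by (smt (verit) zero_le_power2)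
  hence "(cmod (cinner x y))\<^sup>2 \<le> (norm x * norm y)\<^sup>2"
    using n by (simp add: divide_le_eq power_mult_distrib)
  thus ?thesis by (rule power2_le_imp_le) simp
qed simp

lemma norm_scaleC [simp]: "norm (c *\<^sub>C (x :: 'a::complex_inner)) = cmod c * norm x"
proof -
  have "complex_of_real ((norm (c *\<^sub>C x))\<^sup>2) = of_real ((cmod c * norm x)\<^sup>2)"
    unfolding cinner_self[symmetric] cinner_scaleC_left cinner_scaleC_right
    by (simp add: cinner_self power_mult_distrib complex_norm_square[symmetric] mult.commute[of "cnj c" c] del: of_real_power)
  hence "(norm (c *\<^sub>C x))\<^sup>2 = (cmod c * norm x)\<^sup>2" by (simp only: of_real_eq_iff)
  thus ?thesis by (simp add: power2_eq_iff_nonneg)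
qed


section \<open>Bounded operators\<close>

definition bounded_clinear :: "('a::complex_inner \<Rightarrow> 'b::complex_inner) \<Rightarrow> bool" where
  "bounded_clinear A \<longleftrightarrow> bounded_linear A \<and> (\<forall>c x. A (c *\<^sub>C x) = c *\<^sub>C A x)"

text \<open>The adjoint exists and is unique for bounded operators between Hilbert spaces;
  see \<open>cinner_cadjoint\<close> below.\<close>

definition cadjoint :: "('a::complex_inner \<Rightarrow> 'b::complex_inner) \<Rightarrow> 'b \<Rightarrow> 'a" where
  "cadjoint A = (THE B. \<forall>x y. cinner (A x) y = cinner x (B y))"

definition positive_op :: "('a::complex_inner \<Rightarrow> 'a) \<Rightarrow> bool" where
  "positive_op S \<longleftrightarrow> bounded_clinear S \<and> (\<forall>x. cinner (S x) x \<in> \<real>\<^sub>\<ge>\<^sub>0)"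

definition invertible_op :: "('a::complex_inner \<Rightarrow> 'b::complex_inner) \<Rightarrow> bool" where
  "invertible_op S \<longleftrightarrow> bounded_clinear S \<and>
     (\<exists>T. bounded_clinear T \<and> T \<circ> S = id \<and> S \<circ> T = id)"

definition isometry_op :: "('a::complex_inner \<Rightarrow> 'b::complex_inner) \<Rightarrow> bool" where
  "isometry_op U \<longleftrightarrow> bounded_clinear U \<and> (\<forall>x y. cinner (U x) (U y) = cinner x y)"

definition unitary_op :: "('a::complex_inner \<Rightarrow> 'b::complex_inner) \<Rightarrow> bool" where
  "unitary_op U \<longleftrightarrow> isometry_op U \<and> surj U"

lemma riesz_representation:
  fixes f :: "'a::chilbert_space \<Rightarrow> complex"
  assumes f: "bounded_clinear f"
  shows "\<exists>z. \<forall>x. f x = cinner x z"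
proof (cases "\<forall>x. f x = 0")
  case True
  thus ?thesis by (intro exI[of _ 0]) simp
next
  case False
  interpret f: bounded_linear f using f by (simp add: bounded_clinear_def)
  have fC: "f (c *\<^sub>C x) = c * f x" for c x
    using f by (simp add: bounded_clinear_def scaleC_complex_def)
  obtain w where "f w \<noteq> 0" using False by blast
  define S where "S = {x. f x = 1}"
  have "(1 / f w) *\<^sub>C w \<in> S" using \<open>f w \<noteq> 0\<close> by (simp add: S_def fC)
  hence ne: "S \<noteq> {}" by blast
  define d where "d = (INF x\<in>S. norm x)"
  have bdd: "bdd_below (norm ` S)" by (rule bdd_belowI[of _ 0]) auto
  have dle: "d \<le> norm x" if "x \<in> S" for x
    unfolding d_def using that bdd by (intro cINF_lower)
  have d0: "0 \<le> d" unfolding d_def using ne by (intro cINF_greatest) auto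
  have "\<exists>x\<in>S. norm x < d + 1 / real (Suc n)" for n
  proof -
    have "(INF x\<in>S. norm x) < d + 1 / real (Suc n)" by (simp add: d_def)
    thus ?thesis using cINF_less_iff[OF ne bdd] by blast
  qed
  then obtain X where X: "\<And>n. X n \<in> S" "\<And>n. norm (X n) < d + 1 / real (Suc n)" by metis
  have par: "(norm (x - y))\<^sup>2 \<le> 2 * (norm x)\<^sup>2 + 2 * (norm y)\<^sup>2 - 4 * d\<^sup>2" if "x \<in> S" "y \<in> S" for x y
  proof -
    have "(1/2) *\<^sub>R (x + y) \<in> S"
      using that by (simp add: S_def f.scaleR f.add scaleR_conv_of_real)
    from dle[OF this] have "2 * d \<le> norm (x + y)" by simp
    hence "(2 * d)\<^sup>2 \<le> (norm (x + y))\<^sup>2" using d0 by (intro power_mono) auto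
    thus ?thesis using norm_sq_add[of x y] norm_sq_diff[of x y] by (simp add: power_mult_distrib)
  qed
  have "(\<lambda>n. 2 * (d + 1 / real (Suc n))\<^sup>2 - 2 * d\<^sup>2) \<longlonglongrightarrow> 2 * (d + 0)\<^sup>2 - 2 * d\<^sup>2"
    by (intro tendsto_intros LIMSEQ_inverse_real_of_nat[unfolded inverse_eq_divide])
  hence lim0: "(\<lambda>n. 2 * (d + 1 / real (Suc n))\<^sup>2 - 2 * d\<^sup>2) \<longlonglongrightarrow> 0" by simp
  have "Cauchy X"
  proof (rule CauchyI)
    fix e :: real assume e: "0 < e"
    hence "eventually (\<lambda>n. 2 * (d + 1 / real (Suc n))\<^sup>2 - 2 * d\<^sup>2 < e\<^sup>2 / 2) sequentially"
      by (intro order_tendstoD(2)[OF lim0]) simp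
    then obtain N where N: "\<And>n. n \<ge> N \<Longrightarrow> 2 * (d + 1 / real (Suc n))\<^sup>2 - 2 * d\<^sup>2 < e\<^sup>2 / 2"
      unfolding eventually_sequentially by blast
    have Xs: "2 * (norm (X n))\<^sup>2 - 2 * d\<^sup>2 < e\<^sup>2 / 2" if "n \<ge> N" for n
    proof -
      have "(norm (X n))\<^sup>2 \<le> (d + 1 / real (Suc n))\<^sup>2"
        using X(2)[of n] by (intro power_mono) auto
      thus ?thesis using N[OF that] by linarith
    qed
    have "norm (X m - X n) < e" if "m \<ge> N" "n \<ge> N" for m n
    proof -
      have "(norm (X m - X n))\<^sup>2 < e\<^sup>2"
        using par[OF X(1) X(1), of m n] Xs[OF that(1)] Xs[OF that(2)] by linarith
      thus ?thesis using e by (metis power2_less_imp_less less_imp_le)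
    qed
    thus "\<exists>M. \<forall>m\<ge>M. \<forall>n\<ge>M. norm (X m - X n) < e" by blast
  qed
  then obtain z where z: "X \<longlonglongrightarrow> z" using Cauchy_convergent convergent_def by blast
  have "(\<lambda>n. f (X n)) \<longlonglongrightarrow> f z" using z by (rule f.tendsto)
  moreover have "(\<lambda>n. f (X n)) \<longlonglongrightarrow> 1" using X(1) by (simp add: S_def)
  ultimately have fz: "f z = 1" by (rule LIMSEQ_unique)
  have "(\<lambda>n. d + 1 / real (Suc n)) \<longlonglongrightarrow> d + 0"
    by (intro tendsto_intros LIMSEQ_inverse_real_of_nat[unfolded inverse_eq_divide])
  hence "norm z \<le> d"
    using tendsto_norm[OF z] X(2) by (intro LIMSEQ_le[of "\<lambda>n. norm (X n)" _ "\<lambda>n. d + 1 / real (Suc n)"]) (auto intro: less_imp_le)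
  have z0: "norm z \<noteq> 0" using fz f.zero by auto
  have orth: "cinner k z = 0" if "f k = 0" for k
  proof (cases "k = 0")
    case False
    define t where "t = cinner z k / of_real ((norm k)\<^sup>2)"
    have n: "norm k \<noteq> 0" using False by simp
    have "z - t *\<^sub>C k \<in> S" using that fz by (simp add: S_def f.diff fC)
    from dle[OF this] have "norm z \<le> norm (z - t *\<^sub>C k)" using \<open>norm z \<le> d\<close> by linarith
    hence "(norm z)\<^sup>2 \<le> (norm (z - t *\<^sub>C k))\<^sup>2" by (intro power_mono) auto
    also have "\<dots> = (norm z)\<^sup>2 + (cmod t * norm k)\<^sup>2 - 2 * Re (cnj t * cinner z k)"
      by (simp add: norm_sq_diff cinner_scaleC_right)
    also have "cnj t * cinner z k = of_real ((cmod (cinner z k))\<^sup>2 / (norm k)\<^sup>2)"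
      by (simp add: t_def complex_norm_square[symmetric] mult.commute[of _ "cinner z k"])
    also have "(cmod t * norm k)\<^sup>2 = (cmod (cinner z k))\<^sup>2 / (norm k)\<^sup>2"
    proof -
      have "cmod t = cmod (cinner z k) / (norm k)\<^sup>2"
        by (simp add: t_def norm_divide norm_power)
      thus ?thesis using n by (simp add: power2_eq_square)
    qed
    finally have "(cmod (cinner z k))\<^sup>2 / (norm k)\<^sup>2 \<le> 0" by simp
    hence "cinner z k = 0" using n by (simp add: divide_le_0_iff)
    thus ?thesis using cinner_commute[of k z] by simp
  qed simp
  show ?thesis
  proof (intro exI allI)
    fix x
    have "cinner (x - f x *\<^sub>C z) z = 0" by (rule orth) (simp add: f.diff fC fz)
    hence "cinner x z = f x * of_real ((norm z)\<^sup>2)"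
      by (simp add: cinner_diff_left cinner_scaleC_left cinner_self)
    thus "f x = cinner x ((1 / (norm z)\<^sup>2) *\<^sub>R z)"
      using z0 by (simp add: cinner_scaleR_right)
  qed
qed

lemma adjoint_unique:
  fixes A :: "'a::complex_inner \<Rightarrow> 'b::complex_inner"
  assumes "\<And>x y. cinner (A x) y = cinner x (B y)"
  shows "cadjoint A = B"
  unfolding cadjoint_def
proof (rule the_equality)
  fix B' assume B': "\<forall>x y. cinner (A x) y = cinner x (B' y)"
  have "B' y - B y = 0" for y
  proof (rule cinner_eq_zero_all)
    fix x
    have "cinner x (B' y) = cinner x (B y)" using assms[of x y] B' by metis
    thus "cinner x (B' y - B y) = 0" by (simp add: cinner_diff_right)
  qed
  thus "B' = B" by (simp add: fun_eq_iff)
qed (use assms in blast)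

lemma cinner_cadjoint:
  fixes A :: "'a::chilbert_space \<Rightarrow> 'b::complex_inner"
  assumes A: "bounded_clinear A"
  shows "cinner (A x) y = cinner x (cadjoint A y)"
proof -
  interpret A: bounded_linear A using A by (simp add: bounded_clinear_def)
  have "\<exists>z. \<forall>x. cinner (A x) y = cinner x z" for y
  proof (rule riesz_representation)
    obtain K where K: "\<And>x. norm (A x) \<le> norm x * K" using A.bounded by blast
    have "bounded_linear (\<lambda>x. cinner (A x) y)"
    proof (rule bounded_linear_intro[where K = "K * norm y"])
      show "cmod (cinner (A x) y) \<le> norm x * (K * norm y)" for x
        using order_trans[OF cinner_bound mult_right_mono[OF K norm_ge_zero]] by (simp add: mult.assoc)
    qed (simp_all add: A.add A.scaleR cinner_add_left cinner_scaleR_left scaleR_conv_of_real)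
    thus "bounded_clinear (\<lambda>x. cinner (A x) y)"
      using A by (simp add: bounded_clinear_def cinner_scaleC_left scaleC_complex_def)
  qed
  then obtain B where B: "\<And>x y. cinner (A x) y = cinner x (B y)" by metis
  show ?thesis using adjoint_unique[of A B] B by simp
qed


section \<open>The Hilbert space \<open>\<ell>\<^sup>2(X) \<otimes> H\<close>\<close>

text \<open>The type \<open>('x, 'h) ell2\<close> consists of the square-summable functions from \<open>'x\<close> to \<open>'h\<close>.
  In particular \<open>('x, complex) ell2\<close> is the usual space \<open>\<ell>\<^sup>2(X)\<close>; the tensor product
  \<open>\<ell>\<^sup>2(X) \<otimes> H\<close> is realised as \<open>('x, 'h) ell2\<close>, with elementary tensors
  \<open>(\<xi> \<otimes> \<eta>)(x) = \<xi>(x) \<eta>\<close>. That this is a Hilbert space tensor product is the content of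
  \<open>cinner_tensor\<close> and \<open>closure_span_tensor\<close>.\<close>

definition square_summable :: "('x \<Rightarrow> 'h::real_normed_vector) \<Rightarrow> bool" where
  "square_summable f \<longleftrightarrow> (\<lambda>x. (norm (f x))\<^sup>2) summable_on UNIV"

lemma square_summableI:
  assumes "\<And>F. finite F \<Longrightarrow> L2_set (\<lambda>x. norm (f x)) F \<le> B"
  shows "square_summable f"
  unfolding square_summable_def
proof (rule nonneg_bdd_above_summable_on)
  show "bdd_above (sum (\<lambda>x. (norm (f x))\<^sup>2) ` {F. F \<subseteq> UNIV \<and> finite F})"
  proof (rule bdd_aboveI, clarify)
    fix F :: "'a set" assume "finite F"
    from assms[OF this] show "(\<Sum>x\<in>F. (norm (f x))\<^sup>2) \<le> B\<^sup>2"
      by (simp add: L2_set_def real_sqrt_le_iff sqrt_le_D)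
  qed
qed simp

lemma square_summable_L2_set_le:
  assumes "square_summable f" "finite F"
  shows "L2_set (\<lambda>x. norm (f x)) F \<le> sqrt (\<Sum>\<^sub>\<infinity>x. (norm (f x))\<^sup>2)"
  unfolding L2_set_def using assms
  by (intro real_sqrt_le_mono finite_sum_le_infsum) (auto simp: square_summable_def)

lemma square_summable_add:
  assumes "square_summable f" "square_summable g"
  shows "square_summable (\<lambda>x. f x + g x)"
proof (rule square_summableI)
  fix F :: "'a set" assume F: "finite F"
  have "L2_set (\<lambda>x. norm (f x + g x)) F \<le> L2_set (\<lambda>x. norm (f x) + norm (g x)) F"
    by (intro L2_set_mono norm_triangle_ineq) auto
  also have "\<dots> \<le> L2_set (\<lambda>x. norm (f x)) F + L2_set (\<lambda>x. norm (g x)) F"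
    by (rule L2_set_triangle_ineq)
  also have "\<dots> \<le> sqrt (\<Sum>\<^sub>\<infinity>x. (norm (f x))\<^sup>2) + sqrt (\<Sum>\<^sub>\<infinity>x. (norm (g x))\<^sup>2)"
    using square_summable_L2_set_le[OF assms(1) F] square_summable_L2_set_le[OF assms(2) F] by linarith
  finally show "L2_set (\<lambda>x. norm (f x + g x)) F \<le> \<dots>" .
qed

lemma square_summable_scaleC:
  fixes f :: "'x \<Rightarrow> 'h::complex_inner"
  assumes "square_summable f"
  shows "square_summable (\<lambda>x. c *\<^sub>C f x)"
  using assms unfolding square_summable_def
  by (simp add: power_mult_distrib summable_on_cmult_right)

lemma square_summable_scaleR:
  assumes "square_summable f"
  shows "square_summable (\<lambda>x. c *\<^sub>R f x)"
  using assms unfolding square_summable_def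
  by (simp add: power_mult_distrib summable_on_cmult_right)

lemma square_summable_zero: "square_summable (\<lambda>x. 0)"
  by (simp add: square_summable_def)

lemma square_summable_uminus: "square_summable f \<Longrightarrow> square_summable (\<lambda>x. - f x)"
  by (simp add: square_summable_def)

lemma square_summable_diff:
  "square_summable f \<Longrightarrow> square_summable g \<Longrightarrow> square_summable (\<lambda>x. f x - g x)"
  using square_summable_add[of f "\<lambda>x. - g x"] square_summable_uminus[of g] by simp

lemma square_summable_cinner:
  fixes f g :: "'x \<Rightarrow> 'h::complex_inner"
  assumes "square_summable f" "square_summable g"
  shows "(\<lambda>x. cinner (f x) (g x)) summable_on UNIV"
proof (rule abs_summable_summable[OF Infinite_Sum.abs_summable_on_comparison_test'])
  show "(\<lambda>x. (norm (f x))\<^sup>2 + (norm (g x))\<^sup>2) summable_on UNIV"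
    using assms unfolding square_summable_def by (rule summable_on_add)
  fix x
  have "2 * (norm (f x) * norm (g x)) \<le> (norm (f x))\<^sup>2 + (norm (g x))\<^sup>2"
    using sum_squares_bound[of "norm (f x)" "norm (g x)"] by simp
  moreover have "0 \<le> norm (f x) * norm (g x)" by simp
  ultimately show "cmod (cinner (f x) (g x)) \<le> (norm (f x))\<^sup>2 + (norm (g x))\<^sup>2"
    using cinner_bound[of "f x" "g x"] by linarith
qed

typedef (overloaded) ('x, 'h) ell2 = "{f :: 'x \<Rightarrow> 'h::complex_inner. square_summable f}"
  morphisms ell2_apply Abs_ell2
  using square_summable_zero by blast

setup_lifting type_definition_ell2

instantiation ell2 :: (type, complex_inner) complex_inner
begin

lift_definition zero_ell2 :: "('a, 'b) ell2" is "\<lambda>x. 0" by (rule square_summable_zero)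
lift_definition plus_ell2 :: "('a, 'b) ell2 \<Rightarrow> ('a, 'b) ell2 \<Rightarrow> ('a, 'b) ell2"
  is "\<lambda>f g x. f x + g x" by (rule square_summable_add)
lift_definition minus_ell2 :: "('a, 'b) ell2 \<Rightarrow> ('a, 'b) ell2 \<Rightarrow> ('a, 'b) ell2"
  is "\<lambda>f g x. f x - g x" by (rule square_summable_diff)
lift_definition uminus_ell2 :: "('a, 'b) ell2 \<Rightarrow> ('a, 'b) ell2"
  is "\<lambda>f x. - f x" by (rule square_summable_uminus)
lift_definition scaleR_ell2 :: "real \<Rightarrow> ('a, 'b) ell2 \<Rightarrow> ('a, 'b) ell2"
  is "\<lambda>c f x. c *\<^sub>R f x" by (rule square_summable_scaleR)
lift_definition scaleC_ell2 :: "complex \<Rightarrow> ('a, 'b) ell2 \<Rightarrow> ('a, 'b) ell2"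
  is "\<lambda>c f x. c *\<^sub>C f x" by (rule square_summable_scaleC)
lift_definition cinner_ell2 :: "('a, 'b) ell2 \<Rightarrow> ('a, 'b) ell2 \<Rightarrow> complex"
  is "\<lambda>f g. \<Sum>\<^sub>\<infinity>x. cinner (f x) (g x)" .
lift_definition norm_ell2 :: "('a, 'b) ell2 \<Rightarrow> real"
  is "\<lambda>f. sqrt (\<Sum>\<^sub>\<infinity>x. (norm (f x))\<^sup>2)" .
definition sgn_ell2 :: "('a, 'b) ell2 \<Rightarrow> ('a, 'b) ell2" where "sgn_ell2 f = inverse (norm f) *\<^sub>R f"
definition dist_ell2 :: "('a, 'b) ell2 \<Rightarrow> ('a, 'b) ell2 \<Rightarrow> real" where "dist_ell2 f g = norm (f - g)"
definition uniformity_ell2 :: "(('a, 'b) ell2 \<times> ('a, 'b) ell2) filter" where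
  "uniformity_ell2 = (INF e\<in>{0<..}. principal {(x, y). dist x y < e})"
definition open_ell2 :: "('a, 'b) ell2 set \<Rightarrow> bool" where
  "open_ell2 U \<longleftrightarrow> (\<forall>x\<in>U. \<forall>\<^sub>F (x', y) in uniformity. x' = x \<longrightarrow> y \<in> U)"

instance
proof
  fix x y z :: "('a, 'b) ell2" and r s :: real and c d :: complex and U :: "('a, 'b) ell2 set"
  show "x + y + z = x + (y + z)" by transfer (simp add: add.assoc)
  show "x + y = y + x" by transfer (simp add: add.commute)
  show "0 + x = x" by transfer simp
  show "- x + x = 0" by transfer simp
  show "x - y = x + - y" by transfer simp
  show "r *\<^sub>R (x + y) = r *\<^sub>R x + r *\<^sub>R y" by transfer (simp add: scaleR_add_right)
  show "(r + s) *\<^sub>R x = r *\<^sub>R x + s *\<^sub>R x" by transfer (simp add: scaleR_add_left)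
  show "r *\<^sub>R s *\<^sub>R x = (r * s) *\<^sub>R x" by transfer simp
  show "1 *\<^sub>R x = x" by transfer simp
  show "c *\<^sub>C (x + y) = c *\<^sub>C x + c *\<^sub>C y" by transfer (simp add: scaleC_add_right)
  show "(c + d) *\<^sub>C x = c *\<^sub>C x + d *\<^sub>C x" by transfer (simp add: scaleC_add_left)
  show "c *\<^sub>C d *\<^sub>C x = (c * d) *\<^sub>C x" by transfer (simp add: scaleC_scaleC)
  show "complex_of_real r *\<^sub>C x = r *\<^sub>R x" by transfer (simp add: scaleC_of_real)
  show "sgn x = inverse (norm x) *\<^sub>R x" by (rule sgn_ell2_def)
  show "dist x y = norm (x - y)" by (rule dist_ell2_def)
  show "uniformity = (INF e\<in>{0<..}. principal {(x :: ('a, 'b) ell2, y). dist x y < e})"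
    by (rule uniformity_ell2_def)
  show "open U \<longleftrightarrow> (\<forall>x\<in>U. \<forall>\<^sub>F (x', y) in uniformity. x' = x \<longrightarrow> y \<in> U)"
    by (rule open_ell2_def)
  show "norm x = 0 \<longleftrightarrow> x = 0"
  proof transfer
    fix f :: "'a \<Rightarrow> 'b" assume f: "square_summable f"
    show "sqrt (\<Sum>\<^sub>\<infinity>x. (norm (f x))\<^sup>2) = 0 \<longleftrightarrow> f = (\<lambda>x. 0)"
    proof
      assume "sqrt (\<Sum>\<^sub>\<infinity>x. (norm (f x))\<^sup>2) = 0"
      hence "(\<Sum>\<^sub>\<infinity>x. (norm (f x))\<^sup>2) = 0" by simp
      hence "(norm (f x))\<^sup>2 = 0" for x
        using f unfolding square_summable_def
        by (intro nonneg_infsum_le_0D[where A = UNIV and f = "\<lambda>x. (norm (f x))\<^sup>2"]) auto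
      thus "f = (\<lambda>x. 0)" by auto
    qed simp
  qed
  show "norm (x + y) \<le> norm x + norm y"
  proof transfer
    fix f g :: "'a \<Rightarrow> 'b" assume f: "square_summable f" and g: "square_summable g"
    let ?N = "sqrt (\<Sum>\<^sub>\<infinity>x. (norm (f x))\<^sup>2) + sqrt (\<Sum>\<^sub>\<infinity>x. (norm (g x))\<^sup>2)"
    have N: "0 \<le> ?N" by (simp add: infsum_nonneg)
    have "(\<Sum>\<^sub>\<infinity>x. (norm (f x + g x))\<^sup>2) \<le> ?N\<^sup>2"
    proof (rule infsum_le_finite_sums)
      show "(\<lambda>x. (norm (f x + g x))\<^sup>2) summable_on UNIV"
        using square_summable_add[OF f g] by (simp add: square_summable_def)
      fix F :: "'a set" assume F: "finite F"
      have "L2_set (\<lambda>x. norm (f x + g x)) F \<le> L2_set (\<lambda>x. norm (f x) + norm (g x)) F"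
        by (intro L2_set_mono norm_triangle_ineq) auto
      also have "\<dots> \<le> L2_set (\<lambda>x. norm (f x)) F + L2_set (\<lambda>x. norm (g x)) F"
        by (rule L2_set_triangle_ineq)
      also have "\<dots> \<le> ?N"
        using square_summable_L2_set_le[OF f F] square_summable_L2_set_le[OF g F] by linarith
      finally show "(\<Sum>x\<in>F. (norm (f x + g x))\<^sup>2) \<le> ?N\<^sup>2"
        by (simp add: L2_set_def sqrt_le_D)
    qed
    thus "sqrt (\<Sum>\<^sub>\<infinity>x. (norm (f x + g x))\<^sup>2) \<le> ?N" using N by (rule real_le_lsqrt[rotated])
  qed
  show "norm (r *\<^sub>R x) = \<bar>r\<bar> * norm x"
    by transfer (simp add: power_mult_distrib infsum_cmult_right' real_sqrt_mult)
  show "cinner x y = cnj (cinner y x)"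
    unfolding cinner_ell2.rep_eq infsum_cnj[symmetric] by (rule infsum_cong) (rule cinner_commute)
  show "cinner (x + y) z = cinner x z + cinner y z"
    by transfer (simp add: cinner_add_left infsum_add square_summable_cinner)
  show "cinner (c *\<^sub>C x) y = c * cinner x y"
    by transfer (simp add: cinner_scaleC_left infsum_cmult_right')
  show "cinner x x = complex_of_real ((norm x)\<^sup>2)"
  proof transfer
    fix f :: "'a \<Rightarrow> 'b" assume f: "square_summable f"
    have "((\<lambda>x. complex_of_real ((norm (f x))\<^sup>2)) has_sum of_real (\<Sum>\<^sub>\<infinity>x. (norm (f x))\<^sup>2)) UNIV"
      using f by (intro has_sum_of_real has_sum_infsum) (simp add: square_summable_def)
    thus "(\<Sum>\<^sub>\<infinity>x. cinner (f x) (f x)) = complex_of_real ((sqrt (\<Sum>\<^sub>\<infinity>x. (norm (f x))\<^sup>2))\<^sup>2)"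
      by (simp add: cinner_self infsumI infsum_nonneg)
  qed
qed

end

lemma L2_set_le_norm_ell2:
  "finite F \<Longrightarrow> L2_set (\<lambda>x. norm (ell2_apply f x)) F \<le> norm f"
  by transfer (rule square_summable_L2_set_le)

lemma norm_ell2_apply_le: "norm (ell2_apply f x) \<le> norm f"
  using L2_set_le_norm_ell2[of "{x}" f] by simp

lemma norm_ell2_le:
  assumes "\<And>F. finite F \<Longrightarrow> L2_set (\<lambda>x. norm (ell2_apply f x)) F \<le> B"
  shows "norm f \<le> B"
  using assms
proof (transfer fixing: B)
  fix f :: "'a \<Rightarrow> 'b"
  assume f: "square_summable f" and *: "\<And>F. finite F \<Longrightarrow> L2_set (\<lambda>x. norm (f x)) F \<le> B"
  have B: "0 \<le> B" using *[of "{}"] by simp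
  have "(\<Sum>\<^sub>\<infinity>x. (norm (f x))\<^sup>2) \<le> B\<^sup>2"
    using f * by (intro infsum_le_finite_sums) (auto simp: square_summable_def L2_set_def sqrt_le_D)
  thus "sqrt (\<Sum>\<^sub>\<infinity>x. (norm (f x))\<^sup>2) \<le> B" using B by (rule real_le_lsqrt[rotated])
qed

instance ell2 :: (type, chilbert_space) chilbert_space
proof
  fix X :: "nat \<Rightarrow> ('a, 'b) ell2" assume X: "Cauchy X"
  have ap: "norm (ell2_apply (X m) x - ell2_apply (X n) x) \<le> norm (X m - X n)" for m n x
    using norm_ell2_apply_le[of "X m - X n" x] by (simp add: minus_ell2.rep_eq)
  have "Cauchy (\<lambda>n. ell2_apply (X n) x)" for x
  proof (rule CauchyI)
    fix e :: real assume "0 < e"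
    from CauchyD[OF X this] show
      "\<exists>M. \<forall>m\<ge>M. \<forall>n\<ge>M. norm (ell2_apply (X m) x - ell2_apply (X n) x) < e"
      by (meson ap le_less_trans)
  qed
  hence "\<exists>l. (\<lambda>n. ell2_apply (X n) x) \<longlonglongrightarrow> l" for x
    using Cauchy_convergent convergent_def by blast
  then obtain g where g: "\<And>x. (\<lambda>n. ell2_apply (X n) x) \<longlonglongrightarrow> g x" by metis
  have tail: "L2_set (\<lambda>x. norm (ell2_apply (X m) x - g x)) F \<le> e"
    if "finite F" "\<forall>n\<ge>N. norm (X m - X n) \<le> e" for e m N F
  proof (rule LIMSEQ_le_const2)
    show "(\<lambda>n. L2_set (\<lambda>x. norm (ell2_apply (X m) x - ell2_apply (X n) x)) F)
        \<longlonglongrightarrow> L2_set (\<lambda>x. norm (ell2_apply (X m) x - g x)) F"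
      unfolding L2_set_def by (intro tendsto_intros g)
    show "\<exists>N. \<forall>n\<ge>N. L2_set (\<lambda>x. norm (ell2_apply (X m) x - ell2_apply (X n) x)) F \<le> e"
      using that L2_set_le_norm_ell2[OF that(1), of "X m - X n" for n]
      by (auto simp: minus_ell2.rep_eq intro: order_trans)
  qed
  obtain N0 where "\<forall>m\<ge>N0. \<forall>n\<ge>N0. norm (X m - X n) < 1" using CauchyD[OF X, of 1] by auto
  hence "square_summable (\<lambda>x. ell2_apply (X N0) x - g x)"
    by (intro square_summableI[where B = 1] tail[where N = N0]) (auto intro: less_imp_le)
  from square_summable_diff[OF _ this, of "ell2_apply (X N0)"]
  have gs: "square_summable g" using ell2_apply[of "X N0"] by simp
  define G where "G = Abs_ell2 g"
  have G: "ell2_apply G = g" unfolding G_def using gs by (simp add: Abs_ell2_inverse)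
  have "X \<longlonglongrightarrow> G"
  proof (rule LIMSEQ_I)
    fix e :: real assume e: "0 < e"
    then obtain N where N: "\<forall>m\<ge>N. \<forall>n\<ge>N. norm (X m - X n) < e / 2"
      using CauchyD[OF X, of "e / 2"] by auto
    have "norm (X m - G) < e" if "m \<ge> N" for m
    proof -
      have "norm (X m - G) \<le> e / 2"
      proof (rule norm_ell2_le)
        fix F :: "'a set" assume F: "finite F"
        have "\<forall>n\<ge>N. norm (X m - X n) \<le> e / 2" using N that by (blast intro: less_imp_le)
        from tail[OF F this] show "L2_set (\<lambda>x. norm (ell2_apply (X m - G) x)) F \<le> e / 2"
          by (simp only: minus_ell2.rep_eq G)
      qed
      thus ?thesis using e by linarith
    qed
    thus "\<exists>N. \<forall>n\<ge>N. norm (X n - G) < e" by blast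
  qed
  thus "convergent X" by (auto simp: convergent_def)
qed

lift_definition tensor :: "('x, complex) ell2 \<Rightarrow> 'h::complex_inner \<Rightarrow> ('x, 'h) ell2"
  (infixr \<open>\<otimes>\<^sub>h\<close> 70) is "\<lambda>\<xi> \<eta> x. \<xi> x *\<^sub>C \<eta>"
  unfolding square_summable_def by (simp add: power_mult_distrib summable_on_cmult_left)

lemma cinner_tensor: "cinner (\<xi> \<otimes>\<^sub>h \<eta>) (\<xi>' \<otimes>\<^sub>h \<eta>') = cinner \<xi> \<xi>' * cinner \<eta> \<eta>'"
proof transfer
  fix \<xi> \<xi>' :: "'a \<Rightarrow> complex" and \<eta> \<eta>' :: 'b
  have "cinner (\<xi> x *\<^sub>C \<eta>) (\<xi>' x *\<^sub>C \<eta>') = cinner (\<xi> x) (\<xi>' x) * cinner \<eta> \<eta>'" for x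
    by (simp add: cinner_scaleC_left cinner_scaleC_right cinner_complex_def)
  thus "(\<Sum>\<^sub>\<infinity>x. cinner (\<xi> x *\<^sub>C \<eta>) (\<xi>' x *\<^sub>C \<eta>')) = (\<Sum>\<^sub>\<infinity>x. cinner (\<xi> x) (\<xi>' x)) * cinner \<eta> \<eta>'"
    by (simp add: infsum_cmult_left')
qed

lift_definition delta :: "'x \<Rightarrow> ('x, complex) ell2" is "\<lambda>a x. if x = a then 1 else 0"
  unfolding square_summable_def
  by (rule finite_nonzero_values_imp_summable_on) (rule finite_subset[of _ "{a}" for a], auto)

lemma ell2_apply_tensor: "ell2_apply (\<xi> \<otimes>\<^sub>h \<eta>) x = ell2_apply \<xi> x *\<^sub>C \<eta>"
  by transfer simp

lemma ell2_apply_sum: "ell2_apply (sum f F) x = (\<Sum>i\<in>F. ell2_apply (f i) x)"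
  by (induction F rule: infinite_finite_induct) (simp_all add: zero_ell2.rep_eq plus_ell2.rep_eq)

lemma has_sum_delta_tensor:
  fixes f :: "('x, 'h::complex_inner) ell2"
  shows "((\<lambda>x. delta x \<otimes>\<^sub>h ell2_apply f x) has_sum f) UNIV"
  unfolding has_sum_def
proof (rule tendstoI)
  fix e :: real assume e: "0 < e"
  let ?n = "\<lambda>x. (norm (ell2_apply f x))\<^sup>2"
  have sm: "?n summable_on UNIV" using ell2_apply[of f] by (simp add: square_summable_def)
  have "(sum ?n \<longlongrightarrow> infsum ?n UNIV) (finite_subsets_at_top UNIV)"
    using sm by (rule infsum_tendsto)
  hence "eventually (\<lambda>F. dist (sum ?n F) (infsum ?n UNIV) < (e/2)\<^sup>2) (finite_subsets_at_top UNIV)"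
    using e by (intro tendstoD) auto
  then obtain F0 where F0: "finite F0"
    "\<And>F. finite F \<Longrightarrow> F0 \<subseteq> F \<Longrightarrow> dist (sum ?n F) (infsum ?n UNIV) < (e/2)\<^sup>2"
    unfolding eventually_finite_subsets_at_top by auto
  show "eventually (\<lambda>F. dist (\<Sum>x\<in>F. delta x \<otimes>\<^sub>h ell2_apply f x) f < e) (finite_subsets_at_top UNIV)"
    unfolding eventually_finite_subsets_at_top
  proof (intro exI[of _ F0] conjI allI impI)
    fix F assume F: "finite F \<and> F0 \<subseteq> F \<and> F \<subseteq> UNIV"
    let ?s = "\<Sum>x\<in>F. delta x \<otimes>\<^sub>h ell2_apply f x"
    have "ell2_apply ?s y = (\<Sum>x\<in>F. if x = y then ell2_apply f y else 0)" for y
      unfolding ell2_apply_sum ell2_apply_tensor by (rule sum.cong) (auto simp: delta.rep_eq)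
    hence ap: "ell2_apply (?s - f) y = (if y \<in> F then 0 else - ell2_apply f y)" for y
      using F by (simp add: minus_ell2.rep_eq sum.delta)
    have "norm (?s - f) \<le> e / 2"
    proof (rule norm_ell2_le)
      fix E :: "'x set" assume E: "finite E"
      have "(\<Sum>y\<in>E. (norm (ell2_apply (?s - f) y))\<^sup>2) = (\<Sum>y\<in>E - F. ?n y)"
        unfolding ap using E by (intro sum.mono_neutral_cong_right) auto
      also have "\<dots> = sum ?n (E \<union> F) - sum ?n F"
        using E F sum.subset_diff[of F "E \<union> F" ?n] by (simp add: Un_Diff)
      also have "\<dots> \<le> infsum ?n UNIV - sum ?n F"
        using finite_sum_le_infsum[OF sm, of "E \<union> F"] E F by simp
      also have "\<dots> \<le> (e/2)\<^sup>2"
        using F0(2)[of F] F by (simp add: dist_real_def)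
      finally show "L2_set (\<lambda>x. norm (ell2_apply (?s - f) x)) E \<le> e / 2"
        using e unfolding L2_set_def by (intro real_le_lsqrt) auto
    qed
    thus "dist ?s f < e" using e by (simp add: dist_norm)
  qed (use F0 in auto)
qed

lemma closure_span_tensor:
  "closure (span {\<xi> \<otimes>\<^sub>h \<eta> | \<xi> \<eta>. True}) = (UNIV :: ('x, 'h::complex_inner) ell2 set)"
proof -
  have "f \<in> closure (span {\<xi> \<otimes>\<^sub>h \<eta> | \<xi> \<eta>. True})" for f :: "('x, 'h) ell2"
  proof (rule Lim_in_closed_set[OF closed_closure])
    show "((\<lambda>F. \<Sum>x\<in>F. delta x \<otimes>\<^sub>h ell2_apply f x) \<longlongrightarrow> f) (finite_subsets_at_top UNIV)"
      using has_sum_delta_tensor[of f] by (simp add: has_sum_def)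
    have "(\<Sum>x\<in>F. delta x \<otimes>\<^sub>h ell2_apply f x) \<in> span {\<xi> \<otimes>\<^sub>h \<eta> | \<xi> \<eta>. True}" for F
      by (rule span_sum) (auto intro: span_base)
    thus "\<forall>\<^sub>F F in finite_subsets_at_top UNIV.
        (\<Sum>x\<in>F. delta x \<otimes>\<^sub>h ell2_apply f x) \<in> closure (span {\<xi> \<otimes>\<^sub>h \<eta> | \<xi> \<eta>. True})"
      using closure_subset by (intro always_eventually allI) blast
  qed simp
  thus ?thesis by blast
qed

text \<open>\<open>tensor_op S T\<close> is the operator \<open>S \<otimes> T\<close>. The bounded operator in question is unique
  because the elementary tensors span a dense subspace.\<close>

definition tensor_op ::
  "(('x, complex) ell2 \<Rightarrow> ('y, complex) ell2) \<Rightarrow> ('h::complex_inner \<Rightarrow> 'k::complex_inner)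
    \<Rightarrow> ('x, 'h) ell2 \<Rightarrow> ('y, 'k) ell2" where
  "tensor_op S T = (THE R. bounded_clinear R \<and> (\<forall>\<xi> \<eta>. R (\<xi> \<otimes>\<^sub>h \<eta>) = S \<xi> \<otimes>\<^sub>h T \<eta>))"

lemma tensor_op_eqI:
  assumes R: "bounded_clinear R" "\<And>\<xi> \<eta>. R (\<xi> \<otimes>\<^sub>h \<eta>) = S \<xi> \<otimes>\<^sub>h T \<eta>"
  shows "tensor_op S T = R"
  unfolding tensor_op_def
proof (rule the_equality)
  fix R' assume R': "bounded_clinear R' \<and> (\<forall>\<xi> \<eta>. R' (\<xi> \<otimes>\<^sub>h \<eta>) = S \<xi> \<otimes>\<^sub>h T \<eta>)"
  have bl: "bounded_linear R" "bounded_linear R'"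
    using R(1) R' by (auto simp: bounded_clinear_def)
  show "R' = R"
  proof
    fix f
    have "((\<lambda>x. R (delta x \<otimes>\<^sub>h ell2_apply f x)) has_sum R f) UNIV"
      using has_sum_bounded_linear[OF bl(1) has_sum_delta_tensor[of f]] by (simp add: o_def)
    moreover have "((\<lambda>x. R' (delta x \<otimes>\<^sub>h ell2_apply f x)) has_sum R' f) UNIV"
      using has_sum_bounded_linear[OF bl(2) has_sum_delta_tensor[of f]] by (simp add: o_def)
    ultimately show "R' f = R f" using R(2) R' by (auto intro: has_sum_unique)
  qed
qed (use R in blast)


section \<open>Unitary representations\<close>

text \<open>Groups are types of class \<open>group_add\<close>. This class is not assumed to be commutative, so it
  describes arbitrary groups; the group \<open>G\<close> with product \<open>gh\<close>, inverse \<open>g\<^sup>-\<^sup>1\<close> and unit \<open>e\<close>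
  is written additively as \<open>g + h\<close>, \<open>- g\<close> and \<open>0\<close>.\<close>

definition unitary_rep :: "('g::group_add \<Rightarrow> 'h::complex_inner \<Rightarrow> 'h) \<Rightarrow> bool" where
  "unitary_rep \<pi> \<longleftrightarrow> (\<forall>g. unitary_op (\<pi> g)) \<and> (\<forall>g h. \<pi> (g + h) = \<pi> g \<circ> \<pi> h)"

definition csubspace :: "'h::complex_inner set \<Rightarrow> bool" where
  "csubspace M \<longleftrightarrow> subspace M \<and> (\<forall>c. \<forall>x\<in>M. c *\<^sub>C x \<in> M)"

text \<open>A subrepresentation is given by a closed invariant subspace; the representation is then
  \<open>g \<mapsto> \<rho>\<^sub>g|\<^sub>M\<close>.\<close>

definition subrepresentation :: "'h::complex_inner set \<Rightarrow> ('g::group_add \<Rightarrow> 'h \<Rightarrow> 'h) \<Rightarrow> bool" where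
  "subrepresentation M \<rho> \<longleftrightarrow> csubspace M \<and> closed M \<and> (\<forall>g. \<rho> g ` M \<subseteq> M)"

definition unitarily_equivalent_to_restriction ::
  "('g::group_add \<Rightarrow> 'h::complex_inner \<Rightarrow> 'h) \<Rightarrow> ('g \<Rightarrow> 'k::complex_inner \<Rightarrow> 'k) \<Rightarrow> 'k set \<Rightarrow> bool" where
  "unitarily_equivalent_to_restriction \<pi> \<rho> M \<longleftrightarrow>
     (\<exists>U. isometry_op U \<and> range U = M \<and> (\<forall>g x. U (\<pi> g x) = \<rho> g (U x)))"

lemma square_summable_translate:
  fixes f :: "'g::group_add \<Rightarrow> 'h::real_normed_vector"
  assumes "square_summable f"
  shows "square_summable (\<lambda>h. f (- g + h))"
proof -
  have "bij_betw (\<lambda>h. - g + h) UNIV UNIV"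
    by (rule bij_betw_byWitness[where f' = "\<lambda>h. g + h"]) (auto simp: add.assoc[symmetric])
  from summable_on_reindex_bij_betw[OF this, of "\<lambda>h. (norm (f h))\<^sup>2"] assms
  show ?thesis by (simp add: square_summable_def)
qed

lift_definition translation ::
  "'g::group_add \<Rightarrow> ('g, 'h::complex_inner) ell2 \<Rightarrow> ('g, 'h) ell2"
  is "\<lambda>g f h. f (- g + h)" by (rule square_summable_translate)

definition left_regular :: "'g::group_add \<Rightarrow> ('g, complex) ell2 \<Rightarrow> ('g, complex) ell2" where
  "left_regular g = translation g"

definition left_regular_mult ::
  "'g::group_add \<Rightarrow> ('g, 'o::complex_inner) ell2 \<Rightarrow> ('g, 'o) ell2" where
  "left_regular_mult g = tensor_op (left_regular g) id"

lemma left_regular_delta: "left_regular g (delta h) = delta (g + h)"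
proof -
  have "(\<lambda>x. if - g + x = h then 1 else (0 :: complex)) = (\<lambda>x. if x = g + h then 1 else 0)"
    by (metis add.assoc add.left_neutral left_minus right_minus)
  thus ?thesis unfolding left_regular_def by transfer
qed

lemma cinner_translation:
  fixes \<xi> \<zeta> :: "('g::group_add, 'h::complex_inner) ell2"
  shows "cinner (translation g \<xi>) (translation g \<zeta>) = cinner \<xi> \<zeta>"
proof transfer
  fix g :: 'g and \<xi> \<zeta> :: "'g \<Rightarrow> 'h"
  have "bij_betw (\<lambda>h. - g + h) UNIV UNIV"
    by (rule bij_betw_byWitness[where f' = "\<lambda>h. g + h"]) (auto simp: add.assoc[symmetric])
  from infsum_reindex_bij_betw[OF this, of "\<lambda>h. cinner (\<xi> h) (\<zeta> h)"]
  show "(\<Sum>\<^sub>\<infinity>x. cinner (\<xi> (- g + x)) (\<zeta> (- g + x))) = (\<Sum>\<^sub>\<infinity>x. cinner (\<xi> x) (\<zeta> x))" .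
qed

lemma bounded_clinear_translation:
  "bounded_clinear (translation g :: ('g::group_add, 'h::complex_inner) ell2 \<Rightarrow> _)"
proof -
  have "(norm (translation g f))\<^sup>2 = (norm f)\<^sup>2" for f :: "('g, 'h) ell2"
    using cinner_translation[of g f f] unfolding cinner_self by (simp only: of_real_eq_iff)
  hence n: "norm (translation g f) = norm f" for f :: "('g, 'h) ell2"
    by (simp add: power2_eq_iff_nonneg)
  have "bounded_linear (translation g :: ('g, 'h) ell2 \<Rightarrow> _)"
  proof (rule bounded_linear_intro[where K = 1])
    show "translation g (x + y) = translation g x + translation g y" for x y :: "('g, 'h) ell2"
      by transfer simp
    show "translation g (r *\<^sub>R x) = r *\<^sub>R translation g x" for r and x :: "('g, 'h) ell2"
      by transfer simp
  qed (simp add: n)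
  moreover have "translation g (c *\<^sub>C x) = c *\<^sub>C translation g x" for c and x :: "('g, 'h) ell2"
    by transfer simp
  ultimately show ?thesis by (simp add: bounded_clinear_def)
qed

lemma left_regular_mult_eq_translation: "left_regular_mult g = translation g"
  unfolding left_regular_mult_def
proof (rule tensor_op_eqI[OF bounded_clinear_translation])
  show "translation g (\<xi> \<otimes>\<^sub>h \<eta>) = left_regular g \<xi> \<otimes>\<^sub>h id \<eta>" for \<xi> \<eta>
    unfolding left_regular_def by transfer simp
qed

lemma unitary_rep_left_regular_mult:
  "unitary_rep (left_regular_mult :: 'g::group_add \<Rightarrow> ('g, 'o::complex_inner) ell2 \<Rightarrow> _)"
proof -
  have add: "translation (g + h) f = translation g (translation h f)"
    for g h :: 'g and f :: "('g, 'o) ell2"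
    by transfer (simp add: minus_add add.assoc del: add_uminus_conv_diff)
  have zero: "translation 0 f = f" for f :: "('g, 'o) ell2" by transfer simp
  have "surj (translation g :: ('g, 'o) ell2 \<Rightarrow> _)" for g
    by (rule surjI[of _ "translation (- g)"]) (simp add: add[symmetric] zero)
  thus ?thesis
    by (auto simp: unitary_rep_def unitary_op_def isometry_op_def fun_eq_iff add
        left_regular_mult_eq_translation bounded_clinear_translation cinner_translation)
qed


section \<open>Operator-valued frames\<close>

text \<open>\<open>has_sum\<close> is convergence of the net of finite partial sums, here applied to each vector:
  this is convergence in the strong operator topology.\<close>

definition operator_valued_frame :: "('j \<Rightarrow> 'h::complex_inner \<Rightarrow> 'o::complex_inner) \<Rightarrow> bool" where
  "operator_valued_frame A \<longleftrightarrow> (\<forall>j. bounded_clinear (A j)) \<and>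
     (\<exists>S. positive_op S \<and> invertible_op S \<and>
        (\<forall>x. ((\<lambda>j. cadjoint (A j) (A j x)) has_sum S x) UNIV))"

definition operator_frame_generator ::
  "('g::group_add \<Rightarrow> 'h::complex_inner \<Rightarrow> 'h) \<Rightarrow> ('h \<Rightarrow> 'o::complex_inner) \<Rightarrow> bool" where
  "operator_frame_generator \<pi> A \<longleftrightarrow>
     bounded_clinear A \<and> operator_valued_frame (\<lambda>g. A \<circ> \<pi> (- g))"

lemma operator_frame_generator_iff:
  fixes \<pi> :: "'g::group_add \<Rightarrow> 'h::chilbert_space \<Rightarrow> 'h" and A :: "'h \<Rightarrow> 'o::complex_inner"
  assumes \<pi>: "unitary_rep \<pi>"
  shows "operator_frame_generator \<pi> A \<longleftrightarrow> bounded_clinear A \<and>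
     (\<exists>S. positive_op S \<and> invertible_op S \<and>
        (\<forall>x. ((\<lambda>g. \<pi> g (cadjoint A (A (\<pi> (- g) x)))) has_sum S x) UNIV))"
proof (cases "bounded_clinear A")
  case A: True
  have U: "bounded_clinear (\<pi> g)" "cinner (\<pi> g x) (\<pi> g y) = cinner x y" "surj (\<pi> g)" for g x y
    using \<pi> by (auto simp: unitary_rep_def unitary_op_def isometry_op_def)
  have mult: "\<pi> g (\<pi> h x) = \<pi> (g + h) x" for g h x using \<pi> by (simp add: unitary_rep_def)
  have zero: "\<pi> 0 x = x" for x
  proof -
    obtain y where "x = \<pi> 0 y" using U(3)[of 0] by blast
    thus ?thesis using mult[of 0 0 y] by simp
  qed
  have bc: "bounded_clinear (A \<circ> \<pi> (- g))" for g
    using A U(1)[of "- g"] bounded_linear_compose[of A "\<pi> (- g)"]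
    by (auto simp: bounded_clinear_def o_def)
  have adj: "cadjoint (A \<circ> \<pi> (- g)) = (\<lambda>y. \<pi> g (cadjoint A y))" for g
  proof (rule adjoint_unique)
    fix x y
    have "cinner ((A \<circ> \<pi> (- g)) x) y = cinner (\<pi> (- g) x) (cadjoint A y)"
      by (simp add: cinner_cadjoint[OF A])
    also have "\<dots> = cinner (\<pi> g (\<pi> (- g) x)) (\<pi> g (cadjoint A y))" by (simp add: U(2))
    also have "\<pi> g (\<pi> (- g) x) = x" by (simp add: mult zero)
    finally show "cinner ((A \<circ> \<pi> (- g)) x) y = cinner x (\<pi> g (cadjoint A y))" .
  qed
  show ?thesis
    unfolding operator_frame_generator_def operator_valued_frame_def adj using A bc by simp
qed (simp add: operator_frame_generator_def)

end

theory Submission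
  imports Defs
begin

text \<open>A representation contained in \<open>\<lambda> \<otimes> id\<close> through an isometric intertwiner \<open>U\<close> has the
  generator \<open>A x = (U x)(e)\<close>: the intertwining relation gives \<open>A (\<pi>\<^sub>g\<^sup>-\<^sup>1 x) = (U x)(g)\<close>, so the frame
  sum at \<open>x\<close> is \<open>U\<^sup>*\<close> applied to the expansion of \<open>U x\<close> into its coordinates, and the frame operator
  is \<open>U\<^sup>*U = I\<close>.

  Conversely, let \<open>A\<close> be a generator with frame operator \<open>S\<close>. The analysis operator
  \<open>\<theta> x = (A (\<pi>\<^sub>g\<^sup>-\<^sup>1 x))\<^sub>g\<close> maps into \<open>\<ell>\<^sup>2(G) \<otimes> H\<^sub>o\<close>, satisfies \<open>\<theta>\<^sup>*\<theta> = S\<close>, and intertwines \<open>\<pi>\<close> with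
  \<open>\<lambda> \<otimes> id\<close>; hence \<open>S\<close> commutes with \<open>\<pi>\<close>. The isometric part \<open>\<theta>S\<^sup>-\<^sup>1\<^sup>/\<^sup>2\<close> of its polar decomposition is
  then an isometric intertwiner, whose range is the required subrepresentation.

  No functional calculus is needed for \<open>S\<^sup>-\<^sup>1\<^sup>/\<^sup>2\<close>. The operator \<open>S\<^sup>-\<^sup>1\<close> is self-adjoint and bounded
  below, so \<open>\<parallel>I - tS\<^sup>-\<^sup>1\<parallel> < 1\<close> for a small \<open>t > 0\<close>; for \<open>R = I - tS\<^sup>-\<^sup>1\<close> the map
  \<open>X \<mapsto> (R + X\<^sup>2)/2\<close> is a contraction of a ball in the self-adjoint part of the bicommutant of \<open>R\<close>, and its
  fixed point \<open>X\<close> satisfies \<open>(I - X)\<^sup>2 = I - R\<close>.\<close>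

section \<open>Bounded operators on Hilbert spaces\<close>

lemma bounded_clinear_compose:
  "bounded_clinear A \<Longrightarrow> bounded_clinear B \<Longrightarrow> bounded_clinear (A \<circ> B)"
  using bounded_linear_compose[of A B] by (auto simp: bounded_clinear_def o_def)

lemma bounded_clinear_id: "bounded_clinear id"
  by (simp add: bounded_clinear_def id_def)

lemma bounded_linear_scaleC: "bounded_linear (\<lambda>x :: 'a::complex_inner. c *\<^sub>C x)"
proof (rule bounded_linear_intro[where K = "cmod c"])
  show "c *\<^sub>C (r *\<^sub>R x) = r *\<^sub>R c *\<^sub>C x" for r and x :: 'a
    by (simp add: scaleC_of_real[symmetric] scaleC_scaleC mult.commute)
qed (simp_all add: scaleC_add_right mult.commute)

lemma bounded_linear_cinner_left: "bounded_linear (\<lambda>x :: 'a::complex_inner. cinner x y)"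
proof (rule bounded_linear_intro[where K = "norm y"])
  show "norm (cinner x y) \<le> norm x * norm y" for x by (rule cinner_bound)
qed (simp_all add: cinner_add_left cinner_scaleR_left scaleR_conv_of_real)

lemma cinner_ext_left:
  assumes "\<And>y. cinner x y = cinner x' (y :: 'a::complex_inner)"
  shows "x = x'"
proof -
  have "cinner (x - x') (x - x') = 0" using assms by (simp add: cinner_diff_left)
  thus ?thesis by (simp add: cinner_self)
qed

lemma bounded_linear_cadjoint:
  fixes A :: "'a::chilbert_space \<Rightarrow> 'b::complex_inner"
  assumes A: "bounded_clinear A"
  shows "bounded_linear (cadjoint A)"
proof -
  note adj = cinner_cadjoint[OF A]
  have adj': "cinner (cadjoint A y) x = cinner y (A x)" for x y
    using adj[of x y] cinner_commute by metis
  obtain K where K: "K > 0" "\<And>x. norm (A x) \<le> norm x * K"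
    using A bounded_linear.pos_bounded[of A] by (auto simp: bounded_clinear_def)
  show ?thesis
  proof (rule bounded_linear_intro[where K = K])
    show "cadjoint A (x + y) = cadjoint A x + cadjoint A y" for x y
      by (rule cinner_ext_left) (simp add: cinner_add_left adj')
    show "cadjoint A (r *\<^sub>R x) = r *\<^sub>R cadjoint A x" for r x
      by (rule cinner_ext_left) (simp add: cinner_scaleR_left adj')
    fix y
    let ?z = "cadjoint A y"
    have "(norm ?z)\<^sup>2 = cmod (cinner (A ?z) y)"
      unfolding adj cinner_self by (simp add: norm_power)
    also have "\<dots> \<le> norm (A ?z) * norm y" by (rule cinner_bound)
    also have "\<dots> \<le> norm ?z * K * norm y" by (intro mult_right_mono K) simp
    finally have "norm ?z * norm ?z \<le> norm ?z * (norm y * K)"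
      by (simp add: power2_eq_square mult_ac)
    thus "norm ?z \<le> norm y * K"
      using K(1) by (cases "norm ?z = 0") (simp, simp)
  qed
qed

lemma norm_isometry_op:
  assumes "isometry_op U"
  shows "norm (U x) = norm x"
proof -
  have "(norm (U x))\<^sup>2 = (norm x)\<^sup>2"
    using assms unfolding isometry_op_def by (metis cinner_self of_real_eq_iff)
  thus ?thesis by simp
qed

lemma closed_range_isometry_op:
  fixes U :: "'a::chilbert_space \<Rightarrow> 'b::complex_inner"
  assumes U: "isometry_op U"
  shows "closed (range U)"
proof -
  interpret U: bounded_linear U using U by (simp add: isometry_op_def bounded_clinear_def)
  have "complete (range U)"
    by (rule complete_isometric_image[of 1])
      (auto simp: U.bounded_linear_axioms norm_isometry_op[OF U] complete_UNIV)
  thus ?thesis by (rule complete_imp_closed)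
qed

lemma unitary_rep_simps:
  fixes \<pi> :: "'g::group_add \<Rightarrow> 'h::complex_inner \<Rightarrow> 'h"
  assumes "unitary_rep \<pi>"
  shows "bounded_clinear (\<pi> g)" "cinner (\<pi> g x) (\<pi> g y) = cinner x y"
    "\<pi> g (\<pi> h x) = \<pi> (g + h) x" "\<pi> 0 x = x"
proof -
  have *: "unitary_op (\<pi> g)" "\<pi> g (\<pi> h x) = \<pi> (g + h) x" for g h x
    using assms by (auto simp: unitary_rep_def)
  show "bounded_clinear (\<pi> g)" "cinner (\<pi> g x) (\<pi> g y) = cinner x y"
    "\<pi> g (\<pi> h x) = \<pi> (g + h) x"
    using * by (auto simp: unitary_op_def isometry_op_def)
  obtain z where "x = \<pi> 0 z" using *(1)[of 0] by (auto simp: unitary_op_def)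
  thus "\<pi> 0 x = x" using *(2)[of 0 0 z] by simp
qed


section \<open>Square roots of positive operators that are bounded below\<close>

text \<open>The last conjunct says that the square root \<open>P\<close> of \<open>I - R\<close> lies in the bicommutant of \<open>R\<close>. The
  commutant is taken among the real-linear operators: multiplication by a complex scalar is then
  a member, and complex linearity of \<open>P\<close> is a case of this conjunct.\<close>

lemma sqrt_id_minus_contraction:
  fixes R :: "'a::chilbert_space \<Rightarrow> 'a"
  assumes R: "bounded_clinear R"
    and sa: "\<And>x y. cinner (R x) y = cinner x (R y)"
    and q: "0 \<le> q" "q < 1" "\<And>x. norm (R x) \<le> q * norm x"
  shows "\<exists>P. bounded_clinear P \<and> (\<forall>x y. cinner (P x) y = cinner x (P y)) \<and>
    (\<forall>x. P (P x) = x - R x) \<and>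
    (\<forall>V. bounded_linear V \<longrightarrow> (\<forall>x. V (R x) = R (V x)) \<longrightarrow> (\<forall>x. V (P x) = P (V x)))"
proof -
  have blR: "bounded_linear R" using R by (simp add: bounded_clinear_def)
  define \<R> where "\<R> = Blinfun R"
  have \<R>: "blinfun_apply \<R> = R" unfolding \<R>_def by (rule bounded_linear_Blinfun_apply[OF blR])
  have n\<R>: "norm \<R> \<le> q" by (rule norm_blinfun_bound) (use q in \<open>auto simp: \<R>\<close>)
  \<comment> \<open>the smaller root of \<open>r\<^sup>2 - 2r + q\<close>: the ball of radius \<open>r\<close> is mapped into itself\<close>
  define r where "r = 1 - sqrt (1 - q)"
  have r: "0 \<le> r" "r < 1" "(q + r\<^sup>2) / 2 = r"
    using q(1,2) by (auto simp: r_def power2_diff)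
  define F where "F X = (1/2) *\<^sub>R (\<R> + (X o\<^sub>L X))" for X
  define C where "C = {V. bounded_linear V \<and> (\<forall>x. V (R x) = R (V x))}"
  define D where "D = {X. norm X \<le> r \<and>
      (\<forall>x y. cinner (blinfun_apply X x) y = cinner x (blinfun_apply X y)) \<and>
      (\<forall>V\<in>C. \<forall>x. V (blinfun_apply X x) = blinfun_apply X (V x))}"
  have F_apply: "blinfun_apply (F X) x = (1/2) *\<^sub>R (R x + X (X x))" for X x
    by (simp add: F_def blinfun.scaleR_left blinfun.add_left \<R>)
  have "\<exists>!X. X \<in> D \<and> F X = X"
  proof (rule Banach_fix)
    show "complete D"
    proof (unfold complete_eq_closed closed_sequential_limits, intro allI impI, elim conjE)
      fix X :: "nat \<Rightarrow> 'a \<Rightarrow>\<^sub>L 'a" and L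
      assume X: "\<forall>n. X n \<in> D" and lim: "X \<longlonglongrightarrow> L"
      have ap: "(\<lambda>n. X n x) \<longlonglongrightarrow> L x" for x using lim by (intro tendsto_intros)
      have "norm L \<le> r"
        using tendsto_norm[OF lim] X by (intro LIMSEQ_le_const2) (auto simp: D_def)
      moreover have "cinner (L x) y = cinner x (L y)" for x y
      proof (rule LIMSEQ_unique)
        show "(\<lambda>n. cinner (X n x) y) \<longlonglongrightarrow> cinner (L x) y"
          by (rule bounded_linear.tendsto[OF bounded_linear_cinner_left ap])
        have "(\<lambda>n. cnj (cinner (X n y) x)) \<longlonglongrightarrow> cnj (cinner (L y) x)"
          by (intro tendsto_intros bounded_linear.tendsto[OF bounded_linear_cinner_left ap])
        moreover have "cnj (cinner (X n y) x) = cinner (X n x) y" for n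
          using X cinner_commute[of x "X n y"] by (simp add: D_def)
        ultimately show "(\<lambda>n. cinner (X n x) y) \<longlonglongrightarrow> cinner x (L y)"
          using cinner_commute[of x "L y"] by simp
      qed
      moreover have "V (L x) = L (V x)" if "V \<in> C" for V x
      proof (rule LIMSEQ_unique)
        show "(\<lambda>n. V (X n x)) \<longlonglongrightarrow> V (L x)"
          using that by (intro bounded_linear.tendsto[OF _ ap]) (simp add: C_def)
        show "(\<lambda>n. V (X n x)) \<longlonglongrightarrow> L (V x)" using ap[of "V x"] X that by (simp add: D_def)
      qed
      ultimately show "L \<in> D" by (simp add: D_def)
    qed
    have "0 \<in> D" using r(1) by (auto simp: D_def C_def linear_simps)
    thus "D \<noteq> {}" by blast
    show "F ` D \<subseteq> D"
    proof (rule image_subsetI)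
      fix X assume X: "X \<in> D"
      have "norm (F X) \<le> (norm \<R> + norm (X o\<^sub>L X)) / 2"
        using norm_triangle_ineq[of \<R> "X o\<^sub>L X"] by (simp add: F_def)
      also have "\<dots> \<le> (q + r\<^sup>2) / 2"
      proof -
        have "norm (X o\<^sub>L X) \<le> norm X * norm X" by (rule norm_blinfun_compose)
        also have "\<dots> \<le> r\<^sup>2"
          unfolding power2_eq_square using X r(1) by (intro mult_mono) (auto simp: D_def)
        finally show ?thesis using n\<R> by simp
      qed
      finally have "norm (F X) \<le> r" using r(3) by simp
      moreover have "cinner (F X x) y = cinner x (F X y)" for x y
        using X by (simp add: F_apply D_def sa cinner_scaleR_left cinner_scaleR_right
            cinner_add_left cinner_add_right)
      moreover have "V (F X x) = F X (V x)" if V: "V \<in> C" for V x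
      proof -
        have "bounded_linear V" using V by (simp add: C_def)
        then interpret V: bounded_linear V .
        have "V (R x) = R (V x)" "V (X x) = X (V x)" for x using V X by (auto simp: C_def D_def)
        thus ?thesis by (simp add: F_apply V.scaleR V.add)
      qed
      ultimately show "F X \<in> D" by (simp add: D_def)
    qed
    show "dist (F X) (F Y) \<le> r * dist X Y" if X: "X \<in> D" and Y: "Y \<in> D" for X Y
    proof -
      have "F X - F Y = (1/2) *\<^sub>R ((X o\<^sub>L (X - Y)) + ((X - Y) o\<^sub>L Y))"
        by (rule blinfun_eqI) (simp add: F_apply blinfun.scaleR_left blinfun.add_left
            blinfun.diff_left blinfun.diff_right scaleR_add_right scaleR_diff_right)
      hence "norm (F X - F Y) \<le> (norm (X o\<^sub>L (X - Y)) + norm ((X - Y) o\<^sub>L Y)) / 2"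
        using norm_triangle_ineq[of "X o\<^sub>L (X - Y)" "(X - Y) o\<^sub>L Y"] by simp
      also have "\<dots> \<le> (norm X * norm (X - Y) + norm (X - Y) * norm Y) / 2"
        by (intro divide_right_mono add_mono norm_blinfun_compose) simp
      also have "\<dots> \<le> (r * norm (X - Y) + norm (X - Y) * r) / 2"
        using X Y by (intro divide_right_mono add_mono mult_left_mono mult_right_mono)
          (auto simp: D_def)
      finally show ?thesis by (simp add: dist_norm)
    qed
  qed (use r in auto)
  then obtain X where X: "X \<in> D" "F X = X" by blast
  \<comment> \<open>\<open>2X = R + X\<^sup>2\<close> gives \<open>(I - X)\<^sup>2 = I - R\<close>\<close>
  define P where "P x = x - X x" for x
  have comm: "V (P x) = P (V x)" if "V \<in> C" for V x
  proof -
    have "bounded_linear V" using that by (simp add: C_def)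
    then interpret V: bounded_linear V .
    show ?thesis using X(1) that by (simp add: P_def V.diff D_def)
  qed
  have P: "bounded_linear P" unfolding P_def
    by (intro bounded_linear_sub bounded_linear_ident blinfun.bounded_linear_right)
  have "(\<lambda>x. c *\<^sub>C x) \<in> C" for c
    using R bounded_linear_scaleC[of c] by (simp add: C_def bounded_clinear_def)
  from comm[OF this] have "P (c *\<^sub>C x) = c *\<^sub>C P x" for c x by simp
  hence "bounded_clinear P" using P by (simp add: bounded_clinear_def)
  moreover have "cinner (P x) y = cinner x (P y)" for x y
    using X(1) by (simp add: P_def D_def cinner_diff_left cinner_diff_right)
  moreover have "P (P x) = x - R x" for x
  proof -
    have "2 *\<^sub>R X x = 2 *\<^sub>R F X x" by (simp only: X(2))
    hence "X x + X x = R x + X (X x)" by (simp add: F_apply scaleR_2)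
    moreover have "P (P x) = x + X (X x) - (X x + X x)"
      by (simp add: P_def blinfun.diff_right algebra_simps)
    ultimately show ?thesis by simp
  qed
  ultimately show ?thesis using comm by (intro exI[of _ P]) (simp add: C_def)
qed

lemma sqrt_bounded_below:
  fixes T :: "'a::chilbert_space \<Rightarrow> 'a"
  assumes T: "bounded_clinear T"
    and sa: "\<And>x y. cinner (T x) y = cinner x (T y)"
    and c: "c > 0" "\<And>x. c * (norm x)\<^sup>2 \<le> Re (cinner (T x) x)"
  shows "\<exists>P. bounded_clinear P \<and> (\<forall>x y. cinner (P x) y = cinner x (P y)) \<and>
    (\<forall>x. P (P x) = T x) \<and>
    (\<forall>V. bounded_linear V \<longrightarrow> (\<forall>x. V (T x) = T (V x)) \<longrightarrow> (\<forall>x. V (P x) = P (V x)))"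
proof -
  have blT: "bounded_linear T" using T by (simp add: bounded_clinear_def)
  then interpret T: bounded_linear T .
  obtain K0 where K0: "\<And>x. norm (T x) \<le> norm x * K0" using T.bounded by blast
  define K where "K = max K0 c"
  have K: "K > 0" "c \<le> K" using c(1) by (auto simp: K_def)
  have nT: "norm (T x) \<le> K * norm x" for x
  proof -
    have "norm x * K0 \<le> norm x * K" by (intro mult_left_mono) (auto simp: K_def)
    thus ?thesis using K0[of x] by (simp add: mult.commute)
  qed
  \<comment> \<open>\<open>t\<close> minimises \<open>1 - 2tc + t\<^sup>2K\<^sup>2\<close>, a bound for \<open>\<parallel>I - tT\<parallel>\<^sup>2\<close>\<close>
  define t where "t = c / K\<^sup>2"
  define q where "q = sqrt (1 - c\<^sup>2 / K\<^sup>2)"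
  have t: "t > 0" using c(1) K(1) by (simp add: t_def)
  have cK: "c\<^sup>2 / K\<^sup>2 \<le> 1" "0 < c\<^sup>2 / K\<^sup>2" using c(1) K by (auto simp: power_mono)
  have q: "0 \<le> q" "q < 1" "q\<^sup>2 = 1 - c\<^sup>2 / K\<^sup>2" using cK by (auto simp: q_def)
  define R where "R x = x - t *\<^sub>R T x" for x
  have R: "bounded_clinear R"
  proof -
    have "bounded_linear R" unfolding R_def
      by (intro bounded_linear_sub bounded_linear_ident
          bounded_linear_compose[OF bounded_linear_scaleR_right blT])
    moreover have "R (a *\<^sub>C x) = a *\<^sub>C R x" for a x
      using T by (simp add: R_def bounded_clinear_def scaleC_diff_right
          scaleC_of_real[symmetric] scaleC_scaleC mult.commute)
    ultimately show ?thesis by (simp add: bounded_clinear_def)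
  qed
  have "norm (R x) \<le> q * norm x" for x
  proof (rule power2_le_imp_le)
    have "(norm (R x))\<^sup>2 = (norm x)\<^sup>2 + t\<^sup>2 * (norm (T x))\<^sup>2 - 2 * t * Re (cinner (T x) x)"
      using cinner_commute[of x "T x"] unfolding R_def norm_sq_diff
      by (simp add: power_mult_distrib cinner_scaleR_right)
    also have "\<dots> \<le> (norm x)\<^sup>2 + t\<^sup>2 * (K * norm x)\<^sup>2 - 2 * t * (c * (norm x)\<^sup>2)"
      using t by (intro diff_mono add_left_mono mult_left_mono power_mono nT c(2)) auto
    also have "\<dots> = (1 - c\<^sup>2 / K\<^sup>2) * (norm x)\<^sup>2"
      using K(1) by (simp add: t_def field_simps power2_eq_square)
    finally show "(norm (R x))\<^sup>2 \<le> (q * norm x)\<^sup>2" by (simp add: power_mult_distrib q(3))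
  qed (use q(1) in simp)
  moreover have "cinner (R x) y = cinner x (R y)" for x y
    by (simp add: R_def cinner_diff_left cinner_diff_right cinner_scaleR_left
        cinner_scaleR_right sa)
  ultimately obtain Q where Q: "bounded_clinear Q" "\<And>x y. cinner (Q x) y = cinner x (Q y)"
    "\<And>x. Q (Q x) = x - R x"
    "\<And>V x. bounded_linear V \<Longrightarrow> \<forall>x. V (R x) = R (V x) \<Longrightarrow> V (Q x) = Q (V x)"
    using sqrt_id_minus_contraction[OF R _ q(1,2)] by blast
  have blQ: "bounded_linear Q" using Q(1) by (simp add: bounded_clinear_def)
  then interpret Q: bounded_linear Q .
  define P where "P x = (1 / sqrt t) *\<^sub>R Q x" for x
  have "bounded_linear P" unfolding P_def
    by (rule bounded_linear_compose[OF bounded_linear_scaleR_right blQ])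
  moreover have "P (a *\<^sub>C x) = a *\<^sub>C P x" for a x
    using Q(1) by (simp add: P_def bounded_clinear_def scaleC_of_real[symmetric]
        scaleC_scaleC mult.commute)
  ultimately have "bounded_clinear P" by (simp add: bounded_clinear_def)
  moreover have "cinner (P x) y = cinner x (P y)" for x y
    by (simp add: P_def cinner_scaleR_left cinner_scaleR_right Q(2))
  moreover have "P (P x) = T x" for x
    using t by (simp add: P_def Q.scaleR Q(3) R_def)
  moreover have "V (P x) = P (V x)"
    if V: "bounded_linear V" "\<forall>x. V (T x) = T (V x)" for V x
  proof -
    interpret V: bounded_linear V by fact
    have "V (Q x) = Q (V x)" for x
      using V by (intro Q(4)) (auto simp: R_def V.diff V.scaleR)
    thus ?thesis by (simp add: P_def V.scaleR)
  qed
  ultimately show ?thesis by blast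
qed


section \<open>Coordinates in \<open>\<ell>\<^sup>2(X) \<otimes> H\<close>\<close>

lemma cinner_delta_tensor:
  "cinner f (delta a \<otimes>\<^sub>h y) = cinner (ell2_apply f a) (y :: 'h::complex_inner)"
proof -
  have "cinner f (delta a \<otimes>\<^sub>h y)
      = (\<Sum>\<^sub>\<infinity>x\<in>UNIV. cinner (ell2_apply f x) (ell2_apply (delta a) x *\<^sub>C y))"
    by (simp add: cinner_ell2.rep_eq ell2_apply_tensor)
  also have "\<dots> = (\<Sum>\<^sub>\<infinity>x\<in>{a}. cinner (ell2_apply f x) (ell2_apply (delta a) x *\<^sub>C y))"
    by (rule infsum_cong_neutral) (auto simp: delta.rep_eq)
  finally show ?thesis by (simp add: delta.rep_eq)
qed

lemma bounded_clinear_ell2_apply: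
  "bounded_clinear (\<lambda>f :: ('x, 'h::complex_inner) ell2. ell2_apply f a)"
proof -
  have "bounded_linear (\<lambda>f :: ('x, 'h) ell2. ell2_apply f a)"
    by (rule bounded_linear_intro[where K = 1])
      (auto simp: plus_ell2.rep_eq scaleR_ell2.rep_eq norm_ell2_apply_le)
  thus ?thesis by (simp add: bounded_clinear_def scaleC_ell2.rep_eq)
qed


section \<open>Subrepresentations and frame generators\<close>

text \<open>The frame obtained from an isometric intertwiner \<open>U\<close> is normalised: its frame operator is the
  identity.\<close>

lemma operator_frame_generator_of_intertwiner:
  fixes \<pi> :: "'g::group_add \<Rightarrow> 'h::chilbert_space \<Rightarrow> 'h"
    and U :: "'h \<Rightarrow> ('g, 'o::complex_inner) ell2"
  assumes \<pi>: "unitary_rep \<pi>" and U: "isometry_op U"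
    and inter: "\<And>g x. U (\<pi> g x) = translation g (U x)"
  shows "operator_frame_generator \<pi> (\<lambda>x. ell2_apply (U x) 0)"
proof -
  define A where "A x = ell2_apply (U x) 0" for x
  have bcU: "bounded_clinear U" using U by (simp add: isometry_op_def)
  have A: "bounded_clinear A"
    using bounded_clinear_compose[OF bounded_clinear_ell2_apply bcU] by (simp add: A_def[abs_def] o_def)
  have coord: "(A \<circ> \<pi> (- g)) x = ell2_apply (U x) g" for g x
    by (simp add: A_def inter translation.rep_eq)
  have adj: "cadjoint (A \<circ> \<pi> (- g)) = (\<lambda>y. cadjoint U (delta g \<otimes>\<^sub>h y))" for g
    by (rule adjoint_unique)
      (simp only: coord cinner_cadjoint[OF bcU, symmetric] cinner_delta_tensor)
  have UU: "cadjoint U (U x) = x" for x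
  proof (rule cinner_ext_left)
    fix y
    have "cinner y (cadjoint U (U x)) = cinner y x"
      using U by (simp add: cinner_cadjoint[OF bcU, symmetric] isometry_op_def)
    thus "cinner (cadjoint U (U x)) y = cinner x y" by (metis cinner_commute)
  qed
  have "((\<lambda>g. cadjoint (A \<circ> \<pi> (- g)) ((A \<circ> \<pi> (- g)) x)) has_sum id x) UNIV" for x
    unfolding adj coord
    using has_sum_bounded_linear[OF bounded_linear_cadjoint[OF bcU] has_sum_delta_tensor[of "U x"]]
    by (simp add: UU o_def)
  moreover have "positive_op (id :: 'h \<Rightarrow> 'h)"
    by (simp add: positive_op_def bounded_clinear_id cinner_self nonneg_Reals_of_real_iff
        del: of_real_power)
  moreover have "invertible_op (id :: 'h \<Rightarrow> 'h)"
    unfolding invertible_op_def using bounded_clinear_id by (auto intro!: exI[of _ id])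
  moreover have "bounded_clinear (A \<circ> \<pi> (- g))" for g
    by (rule bounded_clinear_compose[OF A unitary_rep_simps(1)[OF \<pi>]])
  ultimately have "operator_frame_generator \<pi> A"
    unfolding operator_frame_generator_def operator_valued_frame_def using A by blast
  thus ?thesis by (simp add: A_def[abs_def])
qed

text \<open>The analysis operator \<open>\<theta>\<close> of an operator-valued frame with frame operator \<open>S\<close>; the last
  equation says \<open>\<theta>\<^sup>*\<theta> = S\<close>.\<close>

lemma analysis_operator:
  fixes A :: "'j \<Rightarrow> 'h::chilbert_space \<Rightarrow> 'o::complex_inner"
  assumes A: "\<And>j. bounded_clinear (A j)" and S: "bounded_clinear S"
    and sum: "\<And>x. ((\<lambda>j. cadjoint (A j) (A j x)) has_sum S x) UNIV"
  shows "\<exists>\<theta> :: 'h \<Rightarrow> ('j, 'o) ell2. bounded_clinear \<theta> \<and>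
    (\<forall>x j. ell2_apply (\<theta> x) j = A j x) \<and> (\<forall>x y. cinner (\<theta> x) (\<theta> y) = cinner (S x) y)"
proof -
  have lin: "bounded_linear (A j)" "A j (c *\<^sub>C x) = c *\<^sub>C A j x" for j c x
    using A by (auto simp: bounded_clinear_def)
  have adj: "cinner (cadjoint (A j) z) y = cinner z (A j y)" for j y z
    using cinner_cadjoint[OF A, of j y z] cinner_commute by metis
  have hs: "((\<lambda>j. cinner (A j x) (A j y)) has_sum cinner (S x) y) UNIV" for x y
    using has_sum_bounded_linear[OF bounded_linear_cinner_left[of y] sum[of x]]
    by (simp add: o_def adj)
  have sq: "square_summable (\<lambda>j. A j x)" for x
    using has_sum_bounded_linear[OF bounded_linear_Re hs[of x x]]
    unfolding square_summable_def by (auto simp: o_def cinner_self summable_on_def)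
  define \<theta> where "\<theta> x = Abs_ell2 (\<lambda>j. A j x)" for x
  have ap: "ell2_apply (\<theta> x) j = A j x" for x j
    using sq[of x] by (simp add: \<theta>_def Abs_ell2_inverse)
  have inner: "cinner (\<theta> x) (\<theta> y) = cinner (S x) y" for x y
    using infsumI[OF hs[of x y]] by (simp add: cinner_ell2.rep_eq ap)
  have ext: "f = g" if "\<And>j. ell2_apply f j = ell2_apply g j" for f g :: "('j, 'o) ell2"
    using that by (simp add: ell2_apply_inject[symmetric] fun_eq_iff)
  obtain K where K: "K > 0" "\<And>x. norm (S x) \<le> norm x * K"
    using S bounded_linear.pos_bounded[of S] by (auto simp: bounded_clinear_def)
  have "bounded_linear \<theta>"
  proof (rule bounded_linear_intro[where K = "sqrt K"])
    show "\<theta> (x + y) = \<theta> x + \<theta> y" for x y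
      by (rule ext) (simp add: ap plus_ell2.rep_eq linear_simps lin)
    show "\<theta> (r *\<^sub>R x) = r *\<^sub>R \<theta> x" for r x
      by (rule ext) (simp add: ap scaleR_ell2.rep_eq linear_simps lin)
    fix x
    have "(norm (\<theta> x))\<^sup>2 = cmod (cinner (S x) x)"
      unfolding inner[symmetric] cinner_self by (simp add: norm_power)
    also have "\<dots> \<le> norm (S x) * norm x" by (rule cinner_bound)
    also have "\<dots> \<le> norm x * K * norm x" by (intro mult_right_mono K) simp
    finally have "(norm (\<theta> x))\<^sup>2 \<le> (norm x * sqrt K)\<^sup>2"
      using K(1) by (simp add: power_mult_distrib power2_eq_square[of "norm x"] mult_ac)
    thus "norm (\<theta> x) \<le> norm x * sqrt K"
      by (rule power2_le_imp_le) (use K(1) in simp)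
  qed
  moreover have "\<theta> (c *\<^sub>C x) = c *\<^sub>C \<theta> x" for c x
    by (rule ext) (simp add: ap scaleC_ell2.rep_eq lin)
  ultimately have "bounded_clinear \<theta>" by (simp add: bounded_clinear_def)
  thus ?thesis using ap inner by blast
qed

text \<open>Polar decomposition: \<open>\<theta>P\<close> with \<open>P = (\<theta>\<^sup>*\<theta>)\<^sup>-\<^sup>1\<^sup>/\<^sup>2\<close> is an isometry, and \<open>P\<close> lies in the bicommutant
  of \<open>\<theta>\<^sup>*\<theta>\<close>.\<close>

lemma polar_isometry:
  fixes \<theta> :: "'h::chilbert_space \<Rightarrow> 'k::complex_inner"
  assumes \<theta>: "bounded_clinear \<theta>" and S: "invertible_op S"
    and inner: "\<And>x y. cinner (\<theta> x) (\<theta> y) = cinner (S x) y"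
  shows "\<exists>P. isometry_op (\<theta> \<circ> P) \<and>
    (\<forall>V. bounded_linear V \<longrightarrow> (\<forall>x. V (S x) = S (V x)) \<longrightarrow> (\<forall>x. V (P x) = P (V x)))"
proof -
  from S obtain T where T: "bounded_clinear T" "\<And>x. T (S x) = x" "\<And>x. S (T x) = x"
    unfolding invertible_op_def by (metis comp_apply id_apply)
  have saS: "cinner (S x) y = cinner x (S y)" for x y
    by (metis inner cinner_commute)
  have saT: "cinner (T x) y = cinner x (T y)" for x y
    using saS[of "T x" "T y"] by (simp add: T(3))
  have comT: "V (T x) = T (V x)" if "\<forall>x. V (S x) = S (V x)" for V x
    using that[rule_format, of "T x"] T(2)[of "V (T x)"] by (simp add: T(3))
  obtain K where K: "K > 0" "\<And>x. norm (\<theta> x) \<le> norm x * K"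
    using \<theta> bounded_linear.pos_bounded[of \<theta>] by (auto simp: bounded_clinear_def)
  \<comment> \<open>for \<open>x = S y\<close>: \<open>\<langle>T x, x\<rangle> = \<parallel>\<theta> y\<parallel>\<^sup>2\<close> and \<open>\<parallel>x\<parallel>\<^sup>2 = \<langle>\<theta> y, \<theta> x\<rangle> \<le> K \<parallel>\<theta> y\<parallel> \<parallel>x\<parallel>\<close>\<close>
  have low: "(1 / K\<^sup>2) * (norm x)\<^sup>2 \<le> Re (cinner (T x) x)" for x
  proof -
    define y where "y = T x"
    have x: "x = S y" by (simp add: y_def T(3))
    have "cinner (T x) x = cinner (\<theta> y) (\<theta> y)" by (simp add: inner x T(2) saS)
    hence eq: "Re (cinner (T x) x) = (norm (\<theta> y))\<^sup>2"
      by (simp add: cinner_self del: of_real_power)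
    have "(norm x)\<^sup>2 = cmod (cinner (\<theta> y) (\<theta> x))"
      by (simp add: inner x[symmetric] cinner_self norm_power)
    also have "\<dots> \<le> norm (\<theta> y) * norm (\<theta> x)" by (rule cinner_bound)
    also have "\<dots> \<le> norm (\<theta> y) * (norm x * K)" by (intro mult_left_mono K) simp
    finally have "norm x * norm x \<le> norm x * (norm (\<theta> y) * K)"
      by (simp add: power2_eq_square mult_ac)
    hence "norm x \<le> norm (\<theta> y) * K"
      using K(1) by (cases "norm x = 0") (simp, simp)
    hence "(norm x)\<^sup>2 \<le> (norm (\<theta> y) * K)\<^sup>2" by (intro power_mono) auto
    thus ?thesis unfolding eq using K(1) by (simp add: power_mult_distrib divide_le_eq)
  qed
  have K2: "1 / K\<^sup>2 > 0" using K(1) by simp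
  obtain P where P: "bounded_clinear P" "\<And>x y. cinner (P x) y = cinner x (P y)"
    "\<And>x. P (P x) = T x"
    "\<And>V x. bounded_linear V \<Longrightarrow> \<forall>x. V (T x) = T (V x) \<Longrightarrow> V (P x) = P (V x)"
    using sqrt_bounded_below[OF T(1) saT K2 low] by blast
  have comm: "V (P x) = P (V x)" if "bounded_linear V" "\<forall>x. V (S x) = S (V x)" for V x
    using that comT by (intro P(4)) auto
  have SP: "S (P x) = P (S x)" for x
    using S by (intro comm) (auto simp: invertible_op_def bounded_clinear_def)
  have "cinner (\<theta> (P x)) (\<theta> (P y)) = cinner x y" for x y
    by (simp add: inner SP P(2)[symmetric] P(3) T(2))
  hence "isometry_op (\<theta> \<circ> P)"
    using bounded_clinear_compose[OF \<theta> P(1)] by (simp add: isometry_op_def)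
  thus ?thesis using comm by blast
qed

lemma intertwiner_of_operator_frame_generator:
  fixes \<pi> :: "'g::group_add \<Rightarrow> 'h::chilbert_space \<Rightarrow> 'h" and A :: "'h \<Rightarrow> 'o::complex_inner"
  assumes \<pi>: "unitary_rep \<pi>" and A: "operator_frame_generator \<pi> A"
  shows "\<exists>U :: 'h \<Rightarrow> ('g, 'o) ell2. isometry_op U \<and> (\<forall>g x. U (\<pi> g x) = translation g (U x))"
proof -
  note rep = unitary_rep_simps[OF \<pi>]
  from A obtain S where S: "invertible_op S" and bc: "\<And>g. bounded_clinear (A \<circ> \<pi> (- g))"
    and sum: "\<And>x. ((\<lambda>g. cadjoint (A \<circ> \<pi> (- g)) ((A \<circ> \<pi> (- g)) x)) has_sum S x) UNIV"
    unfolding operator_frame_generator_def operator_valued_frame_def by blast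
  have bcS: "bounded_clinear S" using S by (simp add: invertible_op_def)
  obtain \<theta> :: "'h \<Rightarrow> ('g, 'o) ell2" where \<theta>: "bounded_clinear \<theta>"
    "\<And>x g. ell2_apply (\<theta> x) g = (A \<circ> \<pi> (- g)) x"
    "\<And>x y. cinner (\<theta> x) (\<theta> y) = cinner (S x) y"
    using analysis_operator[OF bc bcS sum] by blast
  have inter: "\<theta> (\<pi> g x) = translation g (\<theta> x)" for g x
  proof -
    have "ell2_apply (\<theta> (\<pi> g x)) h = ell2_apply (translation g (\<theta> x)) h" for h
      by (simp add: \<theta>(2) translation.rep_eq rep(3) minus_add del: add_uminus_conv_diff)
    thus ?thesis by (simp add: ell2_apply_inject[symmetric] fun_eq_iff)
  qed
  have comm: "\<pi> g (S x) = S (\<pi> g x)" for g x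
  proof (rule cinner_ext_left)
    fix y
    have y: "y = \<pi> g (\<pi> (- g) y)" by (simp add: rep(3,4))
    have "cinner (\<pi> g (S x)) y = cinner (S x) (\<pi> (- g) y)" by (subst y) (rule rep(2))
    also have "\<dots> = cinner (translation g (\<theta> x)) (translation g (\<theta> (\<pi> (- g) y)))"
      by (simp add: \<theta>(3) cinner_translation)
    also have "\<dots> = cinner (S (\<pi> g x)) y"
      unfolding inter[symmetric] y[symmetric] by (rule \<theta>(3))
    finally show "cinner (\<pi> g (S x)) y = cinner (S (\<pi> g x)) y" .
  qed
  obtain P where P: "isometry_op (\<theta> \<circ> P)"
    "\<And>V x. bounded_linear V \<Longrightarrow> \<forall>x. V (S x) = S (V x) \<Longrightarrow> V (P x) = P (V x)"
    using polar_isometry[OF \<theta>(1) S \<theta>(3)] by blast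
  have "\<pi> g (P x) = P (\<pi> g x)" for g x
    using rep(1) comm by (intro P(2)) (auto simp: bounded_clinear_def)
  hence "(\<theta> \<circ> P) (\<pi> g x) = translation g ((\<theta> \<circ> P) x)" for g x
    using inter by (metis comp_apply)
  thus ?thesis using P(1) by blast
qed

lemma subrepresentation_range_intertwiner:
  fixes \<pi> :: "'g::group_add \<Rightarrow> 'h::chilbert_space \<Rightarrow> 'h"
    and \<rho> :: "'g \<Rightarrow> 'k::complex_inner \<Rightarrow> 'k"
  assumes U: "isometry_op U" and inter: "\<And>g x. U (\<pi> g x) = \<rho> g (U x)"
  shows "subrepresentation (range U) \<rho>"
proof -
  have lin: "linear U" and C: "U (c *\<^sub>C x) = c *\<^sub>C U x" for c x
    using U by (auto simp: isometry_op_def bounded_clinear_def bounded_linear.linear)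
  have "csubspace (range U)"
    unfolding csubspace_def using linear_subspace_image[OF lin subspace_UNIV]
    by (auto simp: C[symmetric])
  thus ?thesis
    unfolding subrepresentation_def
    using closed_range_isometry_op[OF U] by (auto simp: inter[symmetric])
qed

theorem theorem6p5:
  fixes \<pi> :: "'g::group_add \<Rightarrow> 'h::chilbert_space \<Rightarrow> 'h"
  assumes "unitary_rep \<pi>"
  shows "(\<exists>M. subrepresentation M (left_regular_mult :: 'g \<Rightarrow> ('g, 'o::chilbert_space) ell2 \<Rightarrow> ('g, 'o) ell2) \<and>
            unitarily_equivalent_to_restriction \<pi> (left_regular_mult :: 'g \<Rightarrow> ('g, 'o) ell2 \<Rightarrow> ('g, 'o) ell2) M)
     \<longleftrightarrow> (\<exists>A :: 'h \<Rightarrow> 'o. operator_frame_generator \<pi> A)"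
proof
  assume "\<exists>M. subrepresentation M (left_regular_mult :: 'g \<Rightarrow> ('g, 'o) ell2 \<Rightarrow> ('g, 'o) ell2) \<and>
            unitarily_equivalent_to_restriction \<pi> (left_regular_mult :: 'g \<Rightarrow> ('g, 'o) ell2 \<Rightarrow> ('g, 'o) ell2) M"
  then obtain U :: "'h \<Rightarrow> ('g, 'o) ell2"
    where "isometry_op U" "\<And>g x. U (\<pi> g x) = translation g (U x)"
    unfolding unitarily_equivalent_to_restriction_def left_regular_mult_eq_translation by blast
  thus "\<exists>A :: 'h \<Rightarrow> 'o. operator_frame_generator \<pi> A"
    using operator_frame_generator_of_intertwiner[OF assms] by blast
next
  assume "\<exists>A :: 'h \<Rightarrow> 'o. operator_frame_generator \<pi> A"
  then obtain A :: "'h \<Rightarrow> 'o" where "operator_frame_generator \<pi> A" by blast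
  from intertwiner_of_operator_frame_generator[OF assms this]
  obtain U :: "'h \<Rightarrow> ('g, 'o) ell2"
    where U: "isometry_op U" "\<And>g x. U (\<pi> g x) = left_regular_mult g (U x)"
    by (auto simp: left_regular_mult_eq_translation)
  have "subrepresentation (range U) left_regular_mult"
    by (rule subrepresentation_range_intertwiner[where \<pi> = \<pi>]) (use U in simp_all)
  moreover have "unitarily_equivalent_to_restriction \<pi> left_regular_mult (range U)"
    unfolding unitarily_equivalent_to_restriction_def using U by blast
  ultimately show "\<exists>M. subrepresentation M (left_regular_mult :: 'g \<Rightarrow> ('g, 'o) ell2 \<Rightarrow> ('g, 'o) ell2) \<and>
            unitarily_equivalent_to_restriction \<pi> (left_regular_mult :: 'g \<Rightarrow> ('g, 'o) ell2 \<Rightarrow> ('g, 'o) ell2) M"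
    by blast
qed

end
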